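(* Let $n\ge2$ and $c>0$. On $\mathbb R^n\setminus\{0\}$, endowed with its canonical affine connection $\nabla^0$ and the canonical Euclidean product $\langle\cdot,\cdot\rangle_0$, consider the smooth function $$f(x_1,\dots,x_n)=\int_0^r(t^n+c)^{\frac1n}\,dt,\qquad r=\sqrt{x_1^2+\cdots+x_n^2},$$ and the matrix $\langle\cdot,\cdot\rangle=\left(\frac{\partial^2f}{\partial x_i\partial x_j}\right)_{1\le i,j\le n}$. Then $\langle\cdot,\cdot\rangle$ is a Riemannian metric and $(\mathbb R^n\setminus\{0\},\nabla^0,\langle\cdot,\cdot\rangle)$ is an affine-Riemann manifold satisfying $\gamma=\gamma^*$ and $\mathrm{tr}_{\langle,\rangle}(\gamma)=0$. Moreover, for all $i\ne j$ and all $u,v\in T_X(\mathbb R^n\setminus\{0\})$, with $X=(x_1,\dots,x_n)$, $$\langle\partial_{x_i},\partial_{x_i}\rangle=\frac{r^{n+2}+c(r^2-x_i^2)}{r^3(r^n+c)^{\frac{n-1}n}},\qquad \langle\partial_{x_i},\partial_{x_j}\rangle=-\frac{c\,x_ix_j}{r^3(r^n+c)^{\frac{n-1}n}},$$ $$\langle u,v\rangle=\frac1{r^3(r^n+c)^{\frac{n-1}n}}\Big((r^n+c)r^2\langle u,v\rangle_0-c\langle u,X\rangle_0\langle v,X\rangle_0\Big),$$ and the Ricci curvature of $\langle\cdot,\cdot\rangle$ is nonnegative.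
   Context: An affine-Riemann manifold $(M,\nabla,\langle\cdot,\cdot\rangle)$ is a manifold with a flat torsionless connection $\nabla$ and a Riemannian metric. $D$ is the Levi-Civita connection of the metric; the difference tensor is $\gamma_XY=D_XY-\nabla_XY$, and $\gamma^*$ is defined by $\langle\gamma^*_XY,Z\rangle=\langle Y,\gamma_XZ\rangle$. For a local orthonormal frame $(E_i)$, $\mathrm{tr}_{\langle,\rangle}(\gamma)=\sum_i\gamma_{E_i}E_i$. The matrix $(\partial^2f/\partial x_i\partial x_j)$ is regarded as the symmetric bilinear form with $\langle\partial_{x_i},\partial_{x_j}\rangle=\partial^2f/\partial x_i\partial x_j$. *)

theory Defs
  imports "HOL-Analysis.Analysis"
begin

text \<open>
  All manifolds here are open subsets of \<open>\<real>\<^sup>n\<close>, described in the global chart given by the inclusion, so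
  that every tangent space is \<open>\<real>\<^sup>n\<close> and the coordinate field \<open>\<partial>\<^sub>i\<close> is the constant field \<open>axis i 1\<close>.
\<close>

fun Ck_on :: "nat \<Rightarrow> 'a::real_normed_vector set \<Rightarrow> ('a \<Rightarrow> 'b::real_normed_vector) \<Rightarrow> bool" where
  "Ck_on 0 U f \<longleftrightarrow> continuous_on U f"
| "Ck_on (Suc k) U f \<longleftrightarrow>
     (\<forall>x\<in>U. f differentiable (at x)) \<and> (\<forall>v. Ck_on k U (\<lambda>x. frechet_derivative f (at x) v))"

definition smooth_on :: "'a::real_normed_vector set \<Rightarrow> ('a \<Rightarrow> 'b::real_normed_vector) \<Rightarrow> bool" where
  "smooth_on U f \<longleftrightarrow> (\<forall>k. Ck_on k U f)"

type_synonym 'n vfield = "real^'n \<Rightarrow> real^'n"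
type_synonym 'n bilin_field = "real^'n \<Rightarrow> real^'n \<Rightarrow> real^'n \<Rightarrow> real"
type_synonym 'n vf_op = "'n vfield \<Rightarrow> 'n vfield \<Rightarrow> 'n vfield"

definition lie_bracket :: "'n::finite vf_op" where
  "lie_bracket X Y x =
     frechet_derivative Y (at x) (X x) - frechet_derivative X (at x) (Y x)"

definition riemannian_metric :: "(real^'n::finite) set \<Rightarrow> 'n bilin_field \<Rightarrow> bool" where
  "riemannian_metric U g \<longleftrightarrow>
     (\<forall>x\<in>U. bilinear (g x) \<and> (\<forall>u v. g x u v = g x v u) \<and> (\<forall>u. u \<noteq> 0 \<longrightarrow> g x u u > 0)) \<and>
     (\<forall>u v. smooth_on U (\<lambda>x. g x u v))"

text \<open>
  Vector fields on an open \<open>V \<subseteq> U\<close> are total functions that are smooth on \<open>V\<close>; their values outside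
  \<open>V\<close> are irrelevant. A connection on \<open>U\<close> is taken together with its restrictions to all open
  \<open>V \<subseteq> U\<close>, so that it can be applied to local frames. The Leibniz rule with the indicator function
  of \<open>V\<close> (which is smooth on \<open>V\<close>) forces the value on \<open>V\<close> to depend on the restriction to \<open>V\<close> only.
\<close>

definition affine_connection :: "(real^'n::finite) set \<Rightarrow> 'n vf_op \<Rightarrow> bool" where
  "affine_connection U D \<longleftrightarrow>
     (\<forall>V. open V \<and> V \<subseteq> U \<longrightarrow>
       (\<forall>X Y Z h. smooth_on V X \<and> smooth_on V Y \<and> smooth_on V Z \<and> smooth_on V (h :: real^'n \<Rightarrow> real) \<longrightarrow>
          smooth_on V (D X Y) \<and>
          (\<forall>x\<in>V.
             D (\<lambda>y. X y + Y y) Z x = D X Z x + D Y Z x \<and>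
             D (\<lambda>y. h y *\<^sub>R X y) Y x = h x *\<^sub>R D X Y x \<and>
             D X (\<lambda>y. Y y + Z y) x = D X Y x + D X Z x \<and>
             D X (\<lambda>y. h y *\<^sub>R Y y) x =
               frechet_derivative h (at x) (X x) *\<^sub>R Y x + h x *\<^sub>R D X Y x)))"

definition torsion_free :: "(real^'n::finite) set \<Rightarrow> 'n vf_op \<Rightarrow> bool" where
  "torsion_free U D \<longleftrightarrow>
     (\<forall>V X Y. open V \<and> V \<subseteq> U \<and> smooth_on V X \<and> smooth_on V Y \<longrightarrow>
        (\<forall>x\<in>V. D X Y x - D Y X x = lie_bracket X Y x))"

definition curvature ::
  "'n::finite vf_op \<Rightarrow> 'n vfield \<Rightarrow> 'n vfield \<Rightarrow> 'n vfield \<Rightarrow> 'n vfield" where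
  "curvature D X Y Z x = D X (D Y Z) x - D Y (D X Z) x - D (lie_bracket X Y) Z x"

definition flat_connection :: "(real^'n::finite) set \<Rightarrow> 'n vf_op \<Rightarrow> bool" where
  "flat_connection U D \<longleftrightarrow>
     (\<forall>V X Y Z. open V \<and> V \<subseteq> U \<and> smooth_on V X \<and> smooth_on V Y \<and> smooth_on V Z \<longrightarrow>
        (\<forall>x\<in>V. curvature D X Y Z x = 0))"

definition metric_compatible :: "(real^'n::finite) set \<Rightarrow> 'n bilin_field \<Rightarrow> 'n vf_op \<Rightarrow> bool" where
  "metric_compatible U g D \<longleftrightarrow>
     (\<forall>V X Y Z. open V \<and> V \<subseteq> U \<and> smooth_on V X \<and> smooth_on V Y \<and> smooth_on V Z \<longrightarrow>
        (\<forall>x\<in>V. frechet_derivative (\<lambda>y. g y (Y y) (Z y)) (at x) (X x) =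
                 g x (D X Y x) (Z x) + g x (Y x) (D X Z x)))"

definition levi_civita :: "(real^'n::finite) set \<Rightarrow> 'n bilin_field \<Rightarrow> 'n vf_op \<Rightarrow> bool" where
  "levi_civita U g D \<longleftrightarrow> affine_connection U D \<and> torsion_free U D \<and> metric_compatible U g D"

definition affine_riemann_manifold ::
  "(real^'n::finite) set \<Rightarrow> 'n vf_op \<Rightarrow> 'n bilin_field \<Rightarrow> bool" where
  "affine_riemann_manifold U N g \<longleftrightarrow>
     open U \<and> affine_connection U N \<and> flat_connection U N \<and> torsion_free U N \<and> riemannian_metric U g"

definition canonical_connection :: "'n::finite vf_op" where
  "canonical_connection X Y x = frechet_derivative Y (at x) (X x)"

definition difference_tensor :: "'n::finite vf_op \<Rightarrow> 'n vf_op \<Rightarrow> 'n vf_op" where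
  "difference_tensor D N X Y x = D X Y x - N X Y x"

definition adjoint_tensor :: "(real^'n::finite) set \<Rightarrow> 'n bilin_field \<Rightarrow> 'n vf_op \<Rightarrow> 'n vf_op" where
  "adjoint_tensor U g T X Y x =
     (THE w. \<forall>Z. smooth_on U Z \<longrightarrow> g x w (Z x) = g x (Y x) (T X Z x))"

definition orthonormal_frame ::
  "(real^'n::finite) set \<Rightarrow> 'n bilin_field \<Rightarrow> ('n \<Rightarrow> 'n vfield) \<Rightarrow> bool" where
  "orthonormal_frame V g E \<longleftrightarrow>
     (\<forall>i. smooth_on V (E i)) \<and>
     (\<forall>x\<in>V. \<forall>i j. g x (E i x) (E j x) = (if i = j then 1 else 0))"

definition frame_trace :: "('n::finite \<Rightarrow> 'n vfield) \<Rightarrow> 'n vf_op \<Rightarrow> 'n vfield" where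
  "frame_trace E T x = (\<Sum>i\<in>UNIV. T (E i) (E i) x)"

text \<open>
  The curvature is tensorial, so tangent vectors may be extended to constant vector fields. The sign
  convention makes round spheres positively curved.
\<close>

definition ricci :: "'n::finite vf_op \<Rightarrow> 'n bilin_field" where
  "ricci D x u v = trace (matrix (\<lambda>w. curvature D (\<lambda>_. w) (\<lambda>_. u) (\<lambda>_. v) x))"

definition partial :: "'n::finite \<Rightarrow> (real^'n \<Rightarrow> real) \<Rightarrow> real^'n \<Rightarrow> real" where
  "partial i f x = frechet_derivative f (at x) (axis i 1)"

definition hessian_form :: "(real^'n::finite \<Rightarrow> real) \<Rightarrow> 'n bilin_field" where
  "hessian_form f x u v = (\<Sum>i\<in>UNIV. \<Sum>j\<in>UNIV. partial i (partial j f) x * u $ i * v $ j)"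

definition potential :: "real \<Rightarrow> real^'n::finite \<Rightarrow> real" where
  "potential c x = integral {0..norm x} (\<lambda>t. (t ^ CARD('n) + c) powr (1 / real CARD('n)))"

end

theory Submission
  imports Defs
begin

text \<open>
  Write the potential as \<open>F(\<bar>x\<bar>\<^sup>2/2)\<close>. The derivative of the Hessian metric \<open>g\<close> is the totally symmetric
  cubic form \<open>\<partial>\<^sup>3f\<close>, so \<open>g(\<gamma>\<^sub>u v, w) = \<partial>\<^sup>3f(u, v, w)/2\<close> defines the Levi-Civita connection
  \<open>\<nabla>\<^sup>0 + \<gamma>\<close>, and every \<open>\<gamma>\<^sub>u\<close> is self-adjoint. The trace of \<open>\<gamma>\<close> is half the \<open>g\<close>-gradient of \<open>log det g\<close>,
  and \<open>det g = f'' (f'/r)\<^sup>n\<^sup>-\<^sup>1 = 1\<close>, where \<open>f' = (r\<^sup>n + c)\<^bsup>1/n\<^esup>\<close>. Symmetry of \<open>\<partial>\<^sup>4f\<close> gives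
  \<open>R(w, u) = - [\<gamma>\<^sub>w, \<gamma>\<^sub>u]\<close>, whence \<open>Ric(u, u) = tr(\<gamma>\<^sub>u\<^sup>2) - tr(\<gamma>\<^sub>a)\<close> with \<open>a = \<gamma>\<^sub>u u\<close>; the last trace vanishes
  and the first one is nonnegative by self-adjointness.
\<close>

section \<open>Calculus of smooth functions\<close>

lemma frechet_derivative_eq:
  "(f has_derivative f') (at x) \<Longrightarrow> frechet_derivative f (at x) = f'"
  using frechet_derivative_at by metis

text \<open>\<open>frechet_derivative\<close> is a choice among all derivatives at \<open>x\<close>.
  Both functions have the same ones, so the equality holds whether or not a derivative
  exists.\<close>

lemma frechet_derivative_cong_open:
  assumes "open U" "x \<in> U" "\<And>y. y \<in> U \<Longrightarrow> f y = g y"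
  shows "frechet_derivative f (at x) = frechet_derivative g (at x)"
proof -
  have "(f has_derivative D) (at x) \<longleftrightarrow> (g has_derivative D) (at x)" for D
    using assms by (metis has_derivative_transform_within_open)
  then show ?thesis
    unfolding frechet_derivative_def by simp
qed

lemma differentiable_cong_open:
  assumes "open U" "x \<in> U" "\<And>y. y \<in> U \<Longrightarrow> f y = g y" "f differentiable (at x)"
  shows "g differentiable (at x)"
  using assms unfolding differentiable_def by (metis has_derivative_transform_within_open)

section \<open>Closure properties of the classes \<open>Ck_on\<close> and
  \<open>smooth_on\<close>\<close>

lemma Ck_on_cong:
  assumes "open U" "\<And>x. x \<in> U \<Longrightarrow> f x = g x" "Ck_on k U f"
  shows "Ck_on k U g"
  using assms(2,3)
proof (induction k arbitrary: f g)
  case 0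
  then show ?case using continuous_on_cong by fastforce
next
  case (Suc k)
  have "g differentiable (at x)" if "x \<in> U" for x
    by (rule differentiable_cong_open[OF assms(1) that Suc.prems(1)]) (use Suc.prems that in auto)
  moreover have "Ck_on k U (\<lambda>x. frechet_derivative g (at x) v)" for v
    by (rule Suc.IH[of "\<lambda>x. frechet_derivative f (at x) v"])
      (use Suc.prems(2) frechet_derivative_cong_open[OF assms(1) _ Suc.prems(1)] in auto)
  ultimately show ?case by simp
qed

text \<open>Continuity of \<open>f\<close> is not a clause of \<open>Ck_on (Suc k)\<close>; it is
  recovered from differentiability in the base case. The step descends to the directional
  derivatives.\<close>

lemma Ck_on_SucD: "Ck_on (Suc k) U f \<Longrightarrow> Ck_on k U f"
proof (induction k arbitrary: f)
  case 0
  then show ?case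
    by (auto intro!: differentiable_imp_continuous_on
        simp: differentiable_on_def differentiable_at_withinI)
next
  case (Suc k)
  then have "Ck_on k U (\<lambda>x. frechet_derivative f (at x) v)" for v
    by (subst (asm) Ck_on.simps(2)) (simp only: Suc.IH)
  with Suc.prems show ?case by simp
qed

lemma Ck_on_subset: "Ck_on k U f \<Longrightarrow> V \<subseteq> U \<Longrightarrow> Ck_on k V f"
proof (induction k arbitrary: f)
  case 0
  then show ?case by (auto intro: continuous_on_subset)
qed auto

lemma Ck_on_SucI:
  assumes "open U" "\<And>x. x \<in> U \<Longrightarrow> (f has_derivative f' x) (at x)"
    and "\<And>v. Ck_on k U (\<lambda>x. f' x v)"
  shows "Ck_on (Suc k) U f"
proof -
  have "Ck_on k U (\<lambda>x. frechet_derivative f (at x) v)" for v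
    by (rule Ck_on_cong[OF assms(1) _ assms(3)[of v]])
      (simp add: frechet_derivative_eq[OF assms(2)])
  then show ?thesis
    using assms(2) by (auto simp: differentiable_def)
qed

lemma Ck_on_const: "Ck_on k U (\<lambda>x. a)"
  by (induction k arbitrary: a) (simp_all add: frechet_derivative_const)

lemma Ck_on_add:
  assumes "open U" "Ck_on k U f" "Ck_on k U g"
  shows "Ck_on k U (\<lambda>x. f x + g x)"
  using assms(2,3)
proof (induction k arbitrary: f g)
  case 0
  then show ?case by (simp add: continuous_on_add)
next
  case (Suc k)
  show ?case
    by (rule Ck_on_SucI[OF assms(1), of _ "\<lambda>x v. frechet_derivative f (at x) v + frechet_derivative g (at x) v"])
      (use Suc in \<open>auto intro!: has_derivative_add simp flip: frechet_derivative_works\<close>)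
qed

text \<open>By the product rule, the derivative is a sum of two terms of the same bilinear form.
  Each of them keeps one factor undifferentiated, which is lowered to class \<open>k\<close> by
  \<open>Ck_on_SucD\<close>. Scaling, multiplication and the inner product are all
  instances.\<close>

lemma Ck_on_bilinear:
  assumes "open U" "bounded_bilinear b" "Ck_on k U f" "Ck_on k U g"
  shows "Ck_on k U (\<lambda>x. b (f x) (g x))"
  using assms(3,4)
proof (induction k arbitrary: f g)
  case 0
  then show ?case by (simp add: bounded_bilinear.continuous_on[OF assms(2)])
next
  case (Suc k)
  show ?case
  proof (rule Ck_on_SucI[OF assms(1), of _
        "\<lambda>x v. b (f x) (frechet_derivative g (at x) v) + b (frechet_derivative f (at x) v) (g x)"])
    show "((\<lambda>x. b (f x) (g x)) has_derivative
        (\<lambda>v. b (f x) (frechet_derivative g (at x) v) + b (frechet_derivative f (at x) v) (g x))) (at x)"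
      if "x \<in> U" for x
      using Suc.prems that
      by (intro bounded_bilinear.FDERIV[OF assms(2)]) (auto simp flip: frechet_derivative_works)
    show "Ck_on k U (\<lambda>x. b (f x) (frechet_derivative g (at x) v) + b (frechet_derivative f (at x) v) (g x))" for v
      using Suc.prems Ck_on_SucD[OF Suc.prems(1)] Ck_on_SucD[OF Suc.prems(2)]
      by (intro Ck_on_add[OF assms(1)] Suc.IH) auto
  qed
qed

text \<open>The derivative contains the exponent \<open>a - 1\<close>, hence the induction over all
  exponents at once.\<close>

lemma Ck_on_powr:
  fixes f :: "'a::real_normed_vector \<Rightarrow> real"
  assumes "open U" "Ck_on k U f" "\<And>x. x \<in> U \<Longrightarrow> f x > 0"
  shows "Ck_on k U (\<lambda>x. f x powr a)"
  using assms(2,3)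
proof (induction k arbitrary: a)
  case 0
  then show ?case by (force intro!: continuous_intros)
next
  case (Suc k)
  show ?case
  proof (rule Ck_on_SucI[OF assms(1), of _
        "\<lambda>x v. (a * f x powr (a - 1)) * frechet_derivative f (at x) v"])
    show "((\<lambda>x. f x powr a) has_derivative
        (\<lambda>v. (a * f x powr (a - 1)) * frechet_derivative f (at x) v)) (at x)"
      if "x \<in> U" for x
    proof -
      have "(f has_derivative frechet_derivative f (at x)) (at x)"
        using Suc.prems that by (simp flip: frechet_derivative_works)
      moreover have "((\<lambda>t. t powr a) has_real_derivative a * f x powr (a - 1)) (at (f x))"
        using Suc.prems that by (intro has_real_derivative_powr) auto
      ultimately show ?thesis
        using has_derivative_compose[of f _ x UNIV "\<lambda>t. t powr a"]
        by (simp add: has_field_derivative_def)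
    qed
    show "Ck_on k U (\<lambda>x. (a * f x powr (a - 1)) * frechet_derivative f (at x) v)" for v
      using Suc.prems Ck_on_SucD[OF Suc.prems(1)]
      by (intro Ck_on_bilinear[OF assms(1) bounded_bilinear_mult] Ck_on_const Suc.IH) auto
  qed
qed

lemma smooth_on_cong:
  "open U \<Longrightarrow> (\<And>x. x \<in> U \<Longrightarrow> f x = g x) \<Longrightarrow> smooth_on U f \<Longrightarrow> smooth_on U g"
  unfolding smooth_on_def using Ck_on_cong by blast

lemma smooth_on_subset: "smooth_on U f \<Longrightarrow> V \<subseteq> U \<Longrightarrow> smooth_on V f"
  unfolding smooth_on_def using Ck_on_subset by blast

lemma smooth_on_const [intro, simp]: "smooth_on U (\<lambda>x. a)"
  unfolding smooth_on_def by (simp add: Ck_on_const)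

lemma smooth_on_add: "open U \<Longrightarrow> smooth_on U f \<Longrightarrow> smooth_on U g \<Longrightarrow> smooth_on U (\<lambda>x. f x + g x)"
  unfolding smooth_on_def by (simp add: Ck_on_add)

lemma smooth_on_bilinear:
  "open U \<Longrightarrow> bounded_bilinear b \<Longrightarrow> smooth_on U f \<Longrightarrow> smooth_on U g \<Longrightarrow> smooth_on U (\<lambda>x. b (f x) (g x))"
  unfolding smooth_on_def by (simp add: Ck_on_bilinear)

lemma smooth_on_scaleR:
  "open U \<Longrightarrow> smooth_on U f \<Longrightarrow> smooth_on U g \<Longrightarrow> smooth_on U (\<lambda>x. f x *\<^sub>R g x)"
  by (rule smooth_on_bilinear[OF _ bounded_bilinear_scaleR])

lemma smooth_on_mult:
  fixes f g :: "'a::real_normed_vector \<Rightarrow> real"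
  shows "open U \<Longrightarrow> smooth_on U f \<Longrightarrow> smooth_on U g \<Longrightarrow> smooth_on U (\<lambda>x. f x * g x)"
  by (rule smooth_on_bilinear[OF _ bounded_bilinear_mult])

lemma smooth_on_inner:
  "open U \<Longrightarrow> smooth_on U f \<Longrightarrow> smooth_on U g \<Longrightarrow> smooth_on U (\<lambda>x. f x \<bullet> g x)"
  by (rule smooth_on_bilinear[OF _ bounded_bilinear_inner])

lemma smooth_on_powr:
  fixes f :: "'a::real_normed_vector \<Rightarrow> real"
  shows "open U \<Longrightarrow> smooth_on U f \<Longrightarrow> (\<And>x. x \<in> U \<Longrightarrow> f x > 0) \<Longrightarrow> smooth_on U (\<lambda>x. f x powr a)"
  unfolding smooth_on_def by (simp add: Ck_on_powr)

lemma smooth_on_diff: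
  assumes "open U" "smooth_on U f" "smooth_on U g"
  shows "smooth_on U (\<lambda>x. f x - g x)"
  using smooth_on_add[OF assms(1,2) smooth_on_scaleR[OF assms(1) smooth_on_const[of _ "-1"] assms(3)]]
  by simp

text \<open>The reciprocal is the real power with exponent -1, which is where positivity of the
  denominator enters.\<close>

lemma smooth_on_divide:
  fixes f g :: "'a::real_normed_vector \<Rightarrow> real"
  assumes "open U" "smooth_on U f" "smooth_on U g" "\<And>x. x \<in> U \<Longrightarrow> g x > 0"
  shows "smooth_on U (\<lambda>x. f x / g x)"
  by (rule smooth_on_cong[OF assms(1) _
        smooth_on_mult[OF assms(1,2) smooth_on_powr[OF assms(1,3), of "-1"]]])
    (use assms(4) in \<open>force simp: powr_minus divide_inverse\<close>)+

lemma smooth_on_power: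
  fixes f :: "'a::real_normed_vector \<Rightarrow> real"
  assumes "open U" "smooth_on U f"
  shows "smooth_on U (\<lambda>x. f x ^ k)"
  by (induction k) (simp_all add: smooth_on_mult assms)

lemma smooth_on_sum:
  assumes "open U" "\<And>i. i \<in> I \<Longrightarrow> smooth_on U (f i)"
  shows "smooth_on U (\<lambda>x. \<Sum>i\<in>I. f i x)"
  using assms(2) by (induction I rule: infinite_finite_induct) (simp_all add: smooth_on_add assms(1))

text \<open>A derivative of class \<open>k\<close> puts \<open>f\<close> in class
  \<open>k + 1\<close>; giving up the surplus order treats \<open>k = 0\<close> along with the
  rest.\<close>

lemma smooth_onI:
  assumes "open U" "\<And>x. x \<in> U \<Longrightarrow> (f has_derivative f' x) (at x)"
    and "\<And>v. smooth_on U (\<lambda>x. f' x v)"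
  shows "smooth_on U f"
  unfolding smooth_on_def
proof
  fix k
  have "Ck_on k U (\<lambda>x. f' x v)" for v
    using assms(3) by (simp add: smooth_on_def)
  from Ck_on_SucD[OF Ck_on_SucI[OF assms(1,2) this]] show "Ck_on k U f" .
qed

lemma smooth_on_id [intro, simp]: "open U \<Longrightarrow> smooth_on U (\<lambda>x. x)"
  by (rule smooth_onI[of U _ "\<lambda>x v. v"]) auto

lemma smooth_on_differentiable: "smooth_on U f \<Longrightarrow> x \<in> U \<Longrightarrow> f differentiable (at x)"
  unfolding smooth_on_def by (drule spec[of _ "Suc 0"]) simp

lemma smooth_on_has_derivative:
  "smooth_on U f \<Longrightarrow> x \<in> U \<Longrightarrow> (f has_derivative frechet_derivative f (at x)) (at x)"
  using smooth_on_differentiable frechet_derivative_works by blast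

lemma smooth_on_directional: "smooth_on U f \<Longrightarrow> smooth_on U (\<lambda>x. frechet_derivative f (at x) v)"
  unfolding smooth_on_def
proof
  fix k
  assume "\<forall>k. Ck_on k U f"
  then have "Ck_on (Suc k) U f" ..
  then show "Ck_on k U (\<lambda>x. frechet_derivative f (at x) v)" by simp
qed

lemma smooth_on_continuous: "smooth_on U f \<Longrightarrow> continuous_on U f"
  unfolding smooth_on_def by (drule spec[of _ 0]) simp

section \<open>Derivatives along vector fields\<close>

lemma linear_axis_expansion:
  fixes L :: "real^'n::finite \<Rightarrow> 'b::real_vector"
  assumes "linear L"
  shows "L v = (\<Sum>i\<in>UNIV. (v $ i) *\<^sub>R L (axis i 1))"
proof -
  have "v = (\<Sum>i\<in>UNIV. (v $ i) *\<^sub>R axis i 1)"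
    using basis_expansion[of v] by (simp add: scalar_mult_eq_scaleR)
  then have "L v = L (\<Sum>i\<in>UNIV. (v $ i) *\<^sub>R axis i 1)"
    by (rule arg_cong)
  then show ?thesis
    by (simp add: linear_sum[OF assms] linear_scale[OF assms])
qed

lemma smooth_on_component:
  assumes "open U" "smooth_on U (X :: _ \<Rightarrow> real^'n::finite)"
  shows "smooth_on U (\<lambda>x. X x $ i)"
  using smooth_on_inner[OF assms smooth_on_const[of _ "axis i 1"]] by (simp add: inner_axis)

lemma frechet_derivative_along_field:
  fixes Y :: "real^'n::finite \<Rightarrow> 'b::real_normed_vector"
  assumes "smooth_on U Y" "x \<in> U"
  shows "frechet_derivative Y (at x) v = (\<Sum>i\<in>UNIV. (v $ i) *\<^sub>R frechet_derivative Y (at x) (axis i 1))"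
  by (rule linear_axis_expansion)
    (use smooth_on_has_derivative[OF assms] has_derivative_linear in blast)

text \<open>Smoothness of the derivative is known in constant directions only. Expanding the moving
  direction \<open>X x\<close> along the axes reduces to these.\<close>

lemma smooth_on_derivative_along_field:
  fixes Y :: "real^'n::finite \<Rightarrow> 'b::real_normed_vector"
  assumes "open U" "smooth_on U X" "smooth_on U Y"
  shows "smooth_on U (\<lambda>x. frechet_derivative Y (at x) (X x))"
proof (rule smooth_on_cong[OF assms(1)])
  show "smooth_on U (\<lambda>x. \<Sum>i\<in>UNIV. (X x $ i) *\<^sub>R frechet_derivative Y (at x) (axis i 1))"
    by (intro smooth_on_sum smooth_on_scaleR smooth_on_component smooth_on_directional assms)
qed (simp add: frechet_derivative_along_field[OF assms(3), symmetric])

section \<open>Symmetry of second derivatives\<close>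

lemma has_real_derivative_along_line:
  fixes f :: "'a::real_normed_vector \<Rightarrow> real"
  assumes "f differentiable (at (p + t *\<^sub>R u))"
  shows "((\<lambda>t. f (p + t *\<^sub>R u)) has_real_derivative frechet_derivative f (at (p + t *\<^sub>R u)) u) (at t)"
proof -
  have f: "(f has_derivative frechet_derivative f (at (p + t *\<^sub>R u))) (at (p + t *\<^sub>R u))"
    using assms frechet_derivative_works by blast
  have "((\<lambda>t. p + t *\<^sub>R u) has_derivative (\<lambda>s. s *\<^sub>R u)) (at t)"
    by (auto intro!: derivative_eq_intros)
  from has_derivative_compose[OF this f] show ?thesis
    unfolding has_field_derivative_def
    by (rule has_derivative_eq_rhs) (simp add: linear_scale[OF has_derivative_linear[OF f]] fun_eq_iff)
qed

text \<open>Two applications of the mean value theorem turn the second difference into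
  \<open>s^2\<close> times the iterated derivative at an intermediate point; continuity of that
  derivative at \<open>x\<close> does the rest.\<close>

lemma second_difference_tendsto:
  fixes f :: "'a::real_normed_vector \<Rightarrow> real"
  assumes U: "open U" "x \<in> U" and f: "smooth_on U f"
  shows "((\<lambda>s. (f (x + s *\<^sub>R u + s *\<^sub>R v) - f (x + s *\<^sub>R u) - f (x + s *\<^sub>R v) + f x) / s\<^sup>2)
    \<longlongrightarrow> frechet_derivative (\<lambda>y. frechet_derivative f (at y) u) (at x) v) (at_right 0)"
proof (rule tendstoI)
  define F where "F = (\<lambda>y. frechet_derivative f (at y) u)"
  define G where "G = (\<lambda>y. frechet_derivative F (at y) v)"
  have F: "smooth_on U F" unfolding F_def by (rule smooth_on_directional[OF f])
  have G: "smooth_on U G" unfolding G_def by (rule smooth_on_directional[OF F])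
  fix e :: real assume "e > 0"
  have "isCont G x"
    using smooth_on_continuous[OF G] U continuous_on_eq_continuous_at by blast
  then obtain r1 where r1: "r1 > 0" "\<And>y. dist y x < r1 \<Longrightarrow> dist (G y) (G x) < e"
    using \<open>e > 0\<close> unfolding continuous_at_eps_delta by metis
  obtain r2 where r2: "r2 > 0" "ball x r2 \<subseteq> U"
    using U open_contains_ball by metis
  define r where "r = min r1 r2"
  \<comment> \<open>For parameters between 0 and \<open>s < d\<close> the displacement stays below
    \<open>r\<close> in norm, hence inside \<open>U\<close> and inside the range given by
    continuity. The added 1 keeps the denominator positive when \<open>u = v = 0\<close>.\<close>
  define d where "d = r / (norm u + norm v + 1)"
  have "norm u + norm v + 1 > 0"
    by (smt (verit) norm_ge_zero)
  then have d: "d > 0" using r1(1) r2(1) by (simp add: d_def r_def)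
  have near: "dist (x + t *\<^sub>R u + t' *\<^sub>R v) x < r" if "s < d" "0 \<le> t" "t \<le> s" "0 \<le> t'" "t' \<le> s" for s t t'
  proof -
    have "dist (x + t *\<^sub>R u + t' *\<^sub>R v) x \<le> t * norm u + t' * norm v"
      using norm_triangle_ineq[of "t *\<^sub>R u" "t' *\<^sub>R v"] that by (simp add: dist_norm add.assoc)
    also have "\<dots> \<le> s * norm u + s * norm v"
      using that by (intro add_mono mult_right_mono) auto
    also have "\<dots> \<le> s * (norm u + norm v + 1)"
      using that by (simp add: algebra_simps)
    also have "\<dots> < r"
      using that(1) \<open>norm u + norm v + 1 > 0\<close> by (simp add: d_def pos_less_divide_eq)
    finally show ?thesis .
  qed
  have inU: "x + t *\<^sub>R u + t' *\<^sub>R v \<in> U" if "s < d" "0 \<le> t" "t \<le> s" "0 \<le> t'" "t' \<le> s" for s t t'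
    using near[OF that] r2(2) by (auto simp: r_def dist_commute)
  have "dist ((f (x + s *\<^sub>R u + s *\<^sub>R v) - f (x + s *\<^sub>R u) - f (x + s *\<^sub>R v) + f x) / s\<^sup>2) (G x) < e"
    if s: "0 < s" "s < d" for s
  proof -
    \<comment> \<open>\<open>h\<close> is the increment of \<open>f\<close> by \<open>s\<close>
      along \<open>v\<close>, with base point moving along \<open>u\<close>; the second difference
      is \<open>h s - h 0\<close>.\<close>
    define h where "h = (\<lambda>t. f ((x + s *\<^sub>R v) + t *\<^sub>R u) - f (x + t *\<^sub>R u))"
    have "(h has_real_derivative F ((x + s *\<^sub>R v) + t *\<^sub>R u) - F (x + t *\<^sub>R u)) (at t)"
      if "0 \<le> t" "t \<le> s" for t
      unfolding h_def F_def
      using inU[of s t s] inU[of s t 0] s that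
      by (intro DERIV_diff has_real_derivative_along_line smooth_on_differentiable[OF f])
        (auto simp: algebra_simps)
    from MVT2[OF s(1) this] obtain t where t: "0 < t" "t < s"
      "h s - h 0 = s * (F ((x + s *\<^sub>R v) + t *\<^sub>R u) - F (x + t *\<^sub>R u))" by auto
    \<comment> \<open>The mean value of \<open>h'\<close> is itself an increment of \<open>F\<close>
      along \<open>v\<close>, so the theorem applies once more and brings in
      \<open>G\<close>.\<close>
    define k where "k = (\<lambda>t'. F ((x + t *\<^sub>R u) + t' *\<^sub>R v))"
    have "(k has_real_derivative G ((x + t *\<^sub>R u) + t' *\<^sub>R v)) (at t')" if "0 \<le> t'" "t' \<le> s" for t'
      unfolding k_def G_def
      using inU[of s t t'] s that t
      by (intro has_real_derivative_along_line smooth_on_differentiable[OF F]) auto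
    from MVT2[OF s(1) this] obtain t' where t': "0 < t'" "t' < s"
      "k s - k 0 = s * G (x + t *\<^sub>R u + t' *\<^sub>R v)" by auto
    have "f (x + s *\<^sub>R u + s *\<^sub>R v) - f (x + s *\<^sub>R u) - f (x + s *\<^sub>R v) + f x = h s - h 0"
      by (simp add: h_def algebra_simps)
    also have "\<dots> = s * (k s - k 0)"
      by (simp add: t(3) k_def algebra_simps)
    also have "\<dots> = s\<^sup>2 * G (x + t *\<^sub>R u + t' *\<^sub>R v)"
      by (simp add: t'(3) power2_eq_square)
    finally show ?thesis
      using s near[of s t t'] t t' by (auto simp: r_def intro: r1(2))
  qed
  then show "\<forall>\<^sub>F s in at_right 0. dist ((f (x + s *\<^sub>R u + s *\<^sub>R v) - f (x + s *\<^sub>R u)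
      - f (x + s *\<^sub>R v) + f x) / s\<^sup>2)
      (frechet_derivative (\<lambda>y. frechet_derivative f (at y) u) (at x) v) < e"
    unfolding eventually_at_right_field using d by (auto simp: G_def F_def)
qed

text \<open>The second difference is unchanged when \<open>u\<close> and \<open>v\<close> are
  swapped, and limits are unique.\<close>

lemma second_derivative_symmetric_real:
  fixes f :: "'a::real_normed_vector \<Rightarrow> real"
  assumes "open U" "x \<in> U" "smooth_on U f"
  shows "frechet_derivative (\<lambda>y. frechet_derivative f (at y) u) (at x) v =
    frechet_derivative (\<lambda>y. frechet_derivative f (at y) v) (at x) u"
proof (rule tendsto_unique[OF trivial_limit_at_right_real second_difference_tendsto[OF assms]])
  have "f (x + s *\<^sub>R v + s *\<^sub>R u) - f (x + s *\<^sub>R v) - f (x + s *\<^sub>R u) + f x =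
    f (x + s *\<^sub>R u + s *\<^sub>R v) - f (x + s *\<^sub>R u) - f (x + s *\<^sub>R v) + f x" for s
    by (simp add: add.assoc add.commute[of "s *\<^sub>R v"])
  with second_difference_tendsto[OF assms, of v u]
  show "((\<lambda>s. (f (x + s *\<^sub>R u + s *\<^sub>R v) - f (x + s *\<^sub>R u) - f (x + s *\<^sub>R v) + f x) / s\<^sup>2)
    \<longlongrightarrow> frechet_derivative (\<lambda>y. frechet_derivative f (at y) v) (at x) u) (at_right 0)"
    by simp
qed

lemma frechet_derivative_inner_const:
  assumes "f differentiable (at x)"
  shows "frechet_derivative (\<lambda>y. f y \<bullet> a) (at x) v = frechet_derivative f (at x) v \<bullet> a"
proof -
  have "(f has_derivative frechet_derivative f (at x)) (at x)"
    using assms frechet_derivative_works by blast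
  from has_derivative_inner_left[OF this, of a] show ?thesis
    by (simp add: frechet_derivative_eq)
qed

text \<open>Pairing with constant vectors reduces this to the real-valued case.\<close>

lemma second_derivative_symmetric:
  fixes f :: "'a::real_normed_vector \<Rightarrow> 'b::real_inner"
  assumes "open U" "x \<in> U" "smooth_on U f"
  shows "frechet_derivative (\<lambda>y. frechet_derivative f (at y) u) (at x) v =
    frechet_derivative (\<lambda>y. frechet_derivative f (at y) v) (at x) u"
proof -
  have *: "frechet_derivative (\<lambda>y. frechet_derivative f (at y) u) (at x) v \<bullet> a =
    frechet_derivative (\<lambda>y. frechet_derivative (\<lambda>y. f y \<bullet> a) (at y) u) (at x) v" for u v a
  proof -
    have "frechet_derivative (\<lambda>y. frechet_derivative (\<lambda>y. f y \<bullet> a) (at y) u) (at x) =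
      frechet_derivative (\<lambda>y. frechet_derivative f (at y) u \<bullet> a) (at x)"
      by (rule frechet_derivative_cong_open[OF assms(1,2)])
        (simp add: frechet_derivative_inner_const[OF smooth_on_differentiable[OF assms(3)]])
    then show ?thesis
      using frechet_derivative_inner_const[OF
          smooth_on_differentiable[OF smooth_on_directional[OF assms(3)] assms(2)], of u a v]
      by simp
  qed
  have "frechet_derivative (\<lambda>y. frechet_derivative f (at y) u) (at x) v \<bullet> a =
    frechet_derivative (\<lambda>y. frechet_derivative f (at y) v) (at x) u \<bullet> a" for a
    unfolding * by (rule second_derivative_symmetric_real[OF assms(1,2)])
      (simp add: smooth_on_inner assms)
  then show ?thesis
    using vector_eq_rdot by blast
qed

section \<open>Connections and traces\<close>

lemma canonical_connection_affine: "affine_connection U (canonical_connection :: 'n::finite vf_op)"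
  unfolding affine_connection_def
proof (intro allI impI, elim conjE, intro conjI ballI)
  fix V :: "(real^'n) set" and X Y Z :: "'n vfield" and h :: "real^'n \<Rightarrow> real"
  assume V: "open V" and X: "smooth_on V X" and Y: "smooth_on V Y" and Z: "smooth_on V Z"
    and h: "smooth_on V h"
  show "smooth_on V (canonical_connection X Y)"
    unfolding canonical_connection_def by (rule smooth_on_derivative_along_field[OF V X Y])
  fix x assume x: "x \<in> V"
  note dY = smooth_on_has_derivative[OF Y x] and dZ = smooth_on_has_derivative[OF Z x]
    and dh = smooth_on_has_derivative[OF h x]
  show "canonical_connection (\<lambda>y. X y + Y y) Z x = canonical_connection X Z x + canonical_connection Y Z x"
    by (simp add: canonical_connection_def linear_add[OF has_derivative_linear[OF dZ]])
  show "canonical_connection (\<lambda>y. h y *\<^sub>R X y) Y x = h x *\<^sub>R canonical_connection X Y x"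
    by (simp add: canonical_connection_def linear_scale[OF has_derivative_linear[OF dY]])
  show "canonical_connection X (\<lambda>y. Y y + Z y) x = canonical_connection X Y x + canonical_connection X Z x"
    by (simp add: canonical_connection_def frechet_derivative_eq[OF has_derivative_add[OF dY dZ]])
  show "canonical_connection X (\<lambda>y. h y *\<^sub>R Y y) x =
      frechet_derivative h (at x) (X x) *\<^sub>R Y x + h x *\<^sub>R canonical_connection X Y x"
    by (simp add: canonical_connection_def frechet_derivative_eq[OF has_derivative_scaleR[OF dh dY]])
qed

lemma canonical_connection_torsion_free: "torsion_free U canonical_connection"
  by (simp add: torsion_free_def canonical_connection_def lie_bracket_def)

text \<open>This is the product rule for the expansion of the derivative of \<open>Y\<close> along
  \<open>X\<close> in the axes: the first summand differentiates \<open>X\<close>, the second one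
  differentiates \<open>Y\<close> twice.\<close>

lemma derivative_along_field_has_derivative:
  fixes X Y :: "'n::finite vfield"
  assumes "open V" "x \<in> V" "smooth_on V X" "smooth_on V Y"
  shows "((\<lambda>y. frechet_derivative Y (at y) (X y)) has_derivative
    (\<lambda>w. frechet_derivative Y (at x) (frechet_derivative X (at x) w) +
      (\<Sum>i\<in>UNIV. X x $ i *\<^sub>R frechet_derivative (\<lambda>y. frechet_derivative Y (at y) (axis i 1)) (at x) w))) (at x)"
proof -
  note dX = smooth_on_has_derivative[OF assms(3,2)]
  have "((\<lambda>y. X y $ i *\<^sub>R frechet_derivative Y (at y) (axis i 1)) has_derivative
      (\<lambda>w. X x $ i *\<^sub>R frechet_derivative (\<lambda>y. frechet_derivative Y (at y) (axis i 1)) (at x) w +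
        frechet_derivative X (at x) w $ i *\<^sub>R frechet_derivative Y (at x) (axis i 1))) (at x)" for i
    by (intro has_derivative_scaleR bounded_linear.has_derivative[OF bounded_linear_vec_nth dX]
        smooth_on_has_derivative[OF smooth_on_directional[OF assms(4)] assms(2)])
  then have "((\<lambda>y. \<Sum>i\<in>UNIV. X y $ i *\<^sub>R frechet_derivative Y (at y) (axis i 1)) has_derivative
      (\<lambda>w. \<Sum>i\<in>UNIV. X x $ i *\<^sub>R frechet_derivative (\<lambda>y. frechet_derivative Y (at y) (axis i 1)) (at x) w +
        frechet_derivative X (at x) w $ i *\<^sub>R frechet_derivative Y (at x) (axis i 1))) (at x)"
    by (intro has_derivative_sum) auto
  then have "((\<lambda>y. \<Sum>i\<in>UNIV. X y $ i *\<^sub>R frechet_derivative Y (at y) (axis i 1)) has_derivative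
      (\<lambda>w. frechet_derivative Y (at x) (frechet_derivative X (at x) w) +
      (\<Sum>i\<in>UNIV. X x $ i *\<^sub>R frechet_derivative (\<lambda>y. frechet_derivative Y (at y) (axis i 1)) (at x) w))) (at x)"
    by (rule has_derivative_eq_rhs)
      (simp add: fun_eq_iff sum.distrib frechet_derivative_along_field[OF assms(4,2), symmetric])
  then show ?thesis
    by (rule has_derivative_transform_within_open[OF _ assms(1,2)])
      (simp add: frechet_derivative_along_field[OF assms(4), symmetric])
qed

text \<open>The first-order terms cancel against the bracket term, and the second-order terms cancel
  each other because \<open>H\<close> is symmetric.\<close>

lemma canonical_connection_flat: "flat_connection U (canonical_connection :: 'n::finite vf_op)"
  unfolding flat_connection_def
proof (intro allI impI, elim conjE, intro ballI)
  fix V :: "(real^'n) set" and X Y Z :: "'n vfield" and x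
  assume V: "open V" "x \<in> V" and X: "smooth_on V X" and Y: "smooth_on V Y" and Z: "smooth_on V Z"
  define H where "H = (\<lambda>i j. frechet_derivative (\<lambda>y. frechet_derivative Z (at y) (axis i 1)) (at x) (axis j 1))"
  have H: "(\<Sum>i\<in>UNIV. Y x $ i *\<^sub>R frechet_derivative (\<lambda>y. frechet_derivative Z (at y) (axis i 1)) (at x) (X x)) =
      (\<Sum>i\<in>UNIV. \<Sum>j\<in>UNIV. (Y x $ i * X x $ j) *\<^sub>R H i j)" for X Y :: "'n vfield"
    by (subst frechet_derivative_along_field[OF smooth_on_directional[OF Z] V(2), of _ "X x"])
      (simp add: H_def scaleR_sum_right)
  have sym: "H i j = H j i" for i j
    unfolding H_def by (rule second_derivative_symmetric[OF V Z])
  have "(\<Sum>i\<in>UNIV. \<Sum>j\<in>UNIV. (Y x $ i * X x $ j) *\<^sub>R H i j) =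
      (\<Sum>i\<in>UNIV. \<Sum>j\<in>UNIV. (X x $ i * Y x $ j) *\<^sub>R H i j)"
    by (subst sum.swap) (simp add: sym mult.commute)
  moreover have "linear (frechet_derivative Z (at x))"
    using smooth_on_has_derivative[OF Z V(2)] has_derivative_linear by blast
  ultimately show "curvature canonical_connection X Y Z x = 0"
    unfolding curvature_def canonical_connection_def
    by (simp add: frechet_derivative_eq[OF derivative_along_field_has_derivative[OF V Y Z]]
        frechet_derivative_eq[OF derivative_along_field_has_derivative[OF V X Z]]
        H lie_bracket_def linear_diff)
qed

section \<open>Linear algebra of frames and traces\<close>

lemma orthonormal_expansion:
  fixes b :: "real^'n::finite \<Rightarrow> real^'n \<Rightarrow> real"
    and e :: "'n \<Rightarrow> real^'n"
  assumes "bilinear b" "\<And>i j. b (e i) (e j) = (if i = j then 1 else 0)"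
  shows "(\<Sum>i\<in>UNIV. b a (e i) *\<^sub>R e i) = a"
proof -
  \<comment> \<open>\<open>\<Phi>\<close> reads off coefficients and \<open>\<Psi>\<close>
    reassembles a vector. Orthonormality gives \<open>\<Phi> (\<Psi> w) = w\<close>, and for
    endomorphisms of a finite-dimensional space a one-sided inverse is two-sided.\<close>
  define \<Phi> :: "real^'n \<Rightarrow> real^'n" where "\<Phi> = (\<lambda>a. \<chi> i. b a (e i))"
  define \<Psi> :: "real^'n \<Rightarrow> real^'n" where "\<Psi> = (\<lambda>w. \<Sum>i\<in>UNIV. w $ i *\<^sub>R e i)"
  have lin: "linear (\<lambda>a. b a y)" for y
    using assms(1) by (simp add: bilinear_def)
  have "linear \<Phi>"
    by (intro linearI) (simp_all add: \<Phi>_def vec_eq_iff linear_add[OF lin] linear_scale[OF lin])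
  moreover have "linear \<Psi>"
    by (intro linearI) (simp_all add: \<Psi>_def scaleR_sum_right sum.distrib algebra_simps)
  moreover have "\<Phi> (\<Psi> w) = w" for w
    by (simp add: \<Phi>_def \<Psi>_def vec_eq_iff linear_sum[OF lin] linear_scale[OF lin] assms(2)
        if_distrib[of "(*) _"] cong: if_cong)
  ultimately have "\<Psi> (\<Phi> a) = a"
    using linear_inverse_left[of \<Phi> \<Psi>] by (auto simp: fun_eq_iff)
  then show ?thesis by (simp add: \<Phi>_def \<Psi>_def)
qed

lemma trace_matrix: "trace (matrix L) = (\<Sum>i\<in>UNIV. L (axis i 1) $ i)"
  by (simp add: trace_def matrix_def)

lemma transpose_matrix_self_adjoint:
  fixes L :: "real^'n::finite \<Rightarrow> real^'n"
  assumes "\<And>v w. L v \<bullet> w = v \<bullet> L w"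
  shows "transpose (matrix L) = matrix L"
proof -
  have "L (axis i 1) $ j = L (axis j 1) $ i" for i j
    using assms[of "axis i 1" "axis j 1"] by (simp add: inner_axis inner_axis')
  then show ?thesis by (simp add: transpose_def matrix_def vec_eq_iff)
qed

text \<open>
  The operator \<open>w \<mapsto> S (S (T w))\<close> is self-adjoint for the inner product \<open>S\<^sup>-\<^sup>2\<close>; cyclicity of the trace
  turns its square into the square of the Euclidean self-adjoint operator \<open>S T S\<close>.
\<close>

lemma trace_square_self_adjoint_nonneg:
  fixes S T :: "real^'n::finite \<Rightarrow> real^'n"
  assumes "linear S" "linear T" "\<And>v w. S v \<bullet> w = v \<bullet> S w" "\<And>v w. T v \<bullet> w = v \<bullet> T w"
  shows "trace (matrix (\<lambda>w. S (S (T (S (S (T w))))))) \<ge> 0"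
proof -
  let ?S = "matrix S" and ?T = "matrix T"
  define C where "C = ?S ** ?T ** ?S"
  have "matrix (S \<circ> (S \<circ> (T \<circ> (S \<circ> (S \<circ> T))))) = ?S ** (?S ** (?T ** (?S ** (?S ** ?T))))"
    by (simp add: matrix_compose linear_compose assms(1,2))
  then have "trace (matrix (\<lambda>w. S (S (T (S (S (T w))))))) = trace (?S ** (?S ** (?T ** (?S ** (?S ** ?T)))))"
    by (simp add: o_def)
  also have "\<dots> = trace (C ** C)"
    by (subst trace_mul_sym) (simp add: C_def matrix_mul_assoc)
  also have "\<dots> = trace (C ** transpose C)"
    by (simp add: C_def matrix_transpose_mul transpose_matrix_self_adjoint assms(3,4) matrix_mul_assoc)
  also have "\<dots> = (\<Sum>i\<in>UNIV. \<Sum>j\<in>UNIV. (C $ i $ j)\<^sup>2)"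
    by (simp add: trace_def matrix_matrix_mult_def transpose_def power2_eq_square)
  also have "\<dots> \<ge> 0"
    by (intro sum_nonneg) auto
  finally show ?thesis .
qed

section \<open>Uniqueness of the Levi-Civita connection\<close>

lemma levi_civita_unique:
  fixes g :: "'n::finite bilin_field"
  assumes g: "riemannian_metric U g" and D: "levi_civita U g D" and D': "levi_civita U g D'"
    and V: "open V" "V \<subseteq> U" "x \<in> V" and X: "smooth_on V X" and Y: "smooth_on V Y"
  shows "D X Y x = D' X Y x"
proof -
  \<comment> \<open>The difference of the two connections is symmetric by torsion-freeness and skew
    with respect to \<open>g\<close> by compatibility. Together these force it to vanish.\<close>
  define S where "S = (\<lambda>X Y. D X Y x - D' X Y x)"
  have x: "x \<in> U" using V by auto
  have bil: "bilinear (g x)" and symm: "g x u v = g x v u" and pos: "u \<noteq> 0 \<Longrightarrow> g x u u > 0" for u v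
    using g x by (auto simp: riemannian_metric_def)
  have S_sym: "S X Y = S Y X" if "smooth_on V X" "smooth_on V Y" for X Y
  proof -
    have "D X Y x - D Y X x = lie_bracket X Y x" "D' X Y x - D' Y X x = lie_bracket X Y x"
      using D D' V that unfolding levi_civita_def torsion_free_def by blast+
    then show ?thesis by (simp add: S_def algebra_simps)
  qed
  have S_skew: "g x (S X Y) (Z x) = - g x (Y x) (S X Z)"
    if "smooth_on V X" "smooth_on V Y" "smooth_on V Z" for X Y Z
  proof -
    have "frechet_derivative (\<lambda>y. g y (Y y) (Z y)) (at x) (X x) = g x (E X Y x) (Z x) + g x (Y x) (E X Z x)"
      if "levi_civita U g E" for E
      using that V \<open>smooth_on V X\<close> \<open>smooth_on V Y\<close> \<open>smooth_on V Z\<close>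
      unfolding levi_civita_def metric_compatible_def by blast
    from this[OF D] this[OF D'] show ?thesis
      by (simp add: S_def bilinear_lsub[OF bil] bilinear_rsub[OF bil])
  qed
  have "g x (S X Y) (Z x) = 0" if Z: "smooth_on V Z" for Z
  proof -
    \<comment> \<open>Alternating the two symmetries three times brings \<open>X\<close>,
      \<open>Y\<close>, \<open>Z\<close> back to their places with a minus sign.\<close>
    have "g x (S X Y) (Z x) = - g x (Y x) (S Z X)"
      using S_skew[OF X Y Z] S_sym[OF X Z] by simp
    also have "\<dots> = g x (S Y Z) (X x)"
      using S_skew[OF Z Y X] S_sym[OF Y Z] by simp
    also have "\<dots> = - g x (S X Y) (Z x)"
      using S_skew[OF Y Z X] S_sym[OF X Y] symm by simp
    finally show ?thesis by simp
  qed
  \<comment> \<open>The constant field with value \<open>S X Y\<close> is an admissible test field,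
    and positivity of \<open>g\<close> then applies.\<close>
  from this[of "\<lambda>_. S X Y"] have "S X Y = 0"
    using pos[of "S X Y"] by fastforce
  then show ?thesis by (simp add: S_def)
qed

section \<open>Hessian metrics of radial potentials\<close>

text \<open>
  The Hessian metric of a potential \<open>F(\<bar>x\<bar>\<^sup>2/2)\<close>, with \<open>A, B, C\<close> the values at \<open>x\<close> of \<open>F', F'', F'''\<close>.
  The eigenvalues of the metric are \<open>A\<close> and, in the direction of \<open>x\<close>, \<open>A + B \<bar>x\<bar>\<^sup>2\<close>; the last assumption
  says that their product \<open>A\<^sup>n\<^sup>-\<^sup>1 (A + B \<bar>x\<bar>\<^sup>2)\<close>, the determinant of the Hessian, is constant.
\<close>

locale radial_hessian =
  fixes A B C :: "real^'n::finite \<Rightarrow> real"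
  assumes A_deriv: "x \<noteq> 0 \<Longrightarrow> (A has_derivative (\<lambda>w. B x * (w \<bullet> x))) (at x)"
    and B_deriv: "x \<noteq> 0 \<Longrightarrow> (B has_derivative (\<lambda>w. C x * (w \<bullet> x))) (at x)"
    and C_deriv: "x \<noteq> 0 \<Longrightarrow> \<exists>E. (C has_derivative (\<lambda>w. E * (w \<bullet> x))) (at x)"
    and C_smooth: "smooth_on (UNIV - {0}) C"
    and A_pos: "x \<noteq> 0 \<Longrightarrow> A x > 0"
    and radial_pos: "x \<noteq> 0 \<Longrightarrow> A x + B x * (x \<bullet> x) > 0"
    and det_const: "x \<noteq> 0 \<Longrightarrow>
      B x * ((real CARD('n) + 2) * A x + (real CARD('n) - 1) * B x * (x \<bullet> x)) + C x * (x \<bullet> x) * A x = 0"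
begin

definition met :: "'n bilin_field" where
  "met x u v = A x * (u \<bullet> v) + B x * (u \<bullet> x) * (v \<bullet> x)"

text \<open>The third derivative of the potential, that is, the derivative of \<open>met\<close> in
  direction \<open>u\<close> evaluated on \<open>v\<close> and \<open>w\<close>.\<close>

definition cubic :: "real^'n \<Rightarrow> real^'n \<Rightarrow> real^'n \<Rightarrow> real^'n \<Rightarrow> real" where
  "cubic x u v w = B x * ((u \<bullet> x) * (v \<bullet> w) + (v \<bullet> x) * (u \<bullet> w) + (w \<bullet> x) * (u \<bullet> v)) +
     C x * (u \<bullet> x) * (v \<bullet> x) * (w \<bullet> x)"

text \<open>The vector representing \<open>cubic x u v\<close> with respect to the Euclidean
  product, before the metric enters.\<close>

definition cubic_vec :: "real^'n \<Rightarrow> real^'n \<Rightarrow> real^'n \<Rightarrow> real^'n" where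
  "cubic_vec x u v = B x *\<^sub>R ((u \<bullet> x) *\<^sub>R v + (v \<bullet> x) *\<^sub>R u + (u \<bullet> v) *\<^sub>R x) +
     (C x * (u \<bullet> x) * (v \<bullet> x)) *\<^sub>R x"

text \<open>The inverse of the metric matrix, a multiple of the identity plus a rank-one term, by
  the Sherman-Morrison formula.\<close>

definition sharp :: "real^'n \<Rightarrow> real^'n \<Rightarrow> real^'n" where
  "sharp x y = (1 / A x) *\<^sub>R (y - (B x / (A x + B x * (x \<bullet> x)) * (y \<bullet> x)) *\<^sub>R x)"

text \<open>The Christoffel symbols. As the first derivatives of the metric are totally symmetric,
  the three terms of the Koszul formula collapse to half of \<open>cubic\<close>.\<close>

definition gam :: "real^'n \<Rightarrow> real^'n \<Rightarrow> real^'n \<Rightarrow> real^'n" where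
  "gam x u v = sharp x ((1 / 2) *\<^sub>R cubic_vec x u v)"

definition conn :: "'n vf_op" where
  "conn X Y x = frechet_derivative Y (at x) (X x) + gam x (X x) (Y x)"

section \<open>The metric and its Levi-Civita connection\<close>

lemma open_punctured: "open (UNIV - {0 :: real^'n})"
  by (simp add: open_delete)

lemma B_smooth: "smooth_on (UNIV - {0}) B"
  by (rule smooth_onI[OF open_punctured B_deriv])
    (auto intro!: smooth_on_mult smooth_on_inner C_smooth open_punctured)

lemma A_smooth: "smooth_on (UNIV - {0}) A"
  by (rule smooth_onI[OF open_punctured A_deriv])
    (auto intro!: smooth_on_mult smooth_on_inner B_smooth open_punctured)

lemma met_bilinear: "bilinear (met x)"
  by (auto simp: bilinear_def linear_iff met_def inner_simps algebra_simps)

lemma met_sym: "met x u v = met x v u"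
  by (simp add: met_def inner_commute)

text \<open>For \<open>B x < 0\<close> the Cauchy-Schwarz inequality bounds the form below by the
  radial eigenvalue times \<open>u \<bullet> u\<close>; otherwise \<open>A x\<close> alone
  suffices.\<close>

lemma met_pos:
  assumes "x \<noteq> 0" "u \<noteq> 0"
  shows "met x u u > 0"
proof (cases "B x \<ge> 0")
  case True
  have "A x * (u \<bullet> u) > 0"
    using assms by (simp add: A_pos)
  moreover have "B x * (u \<bullet> x) * (u \<bullet> x) \<ge> 0"
    using True by (simp add: mult.assoc)
  ultimately show ?thesis by (simp add: met_def)
next
  case False
  have "0 < (A x + B x * (x \<bullet> x)) * (u \<bullet> u)"
    using assms radial_pos by simp
  also have "\<dots> = A x * (u \<bullet> u) + B x * ((u \<bullet> u) * (x \<bullet> x))"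
    by (simp add: algebra_simps)
  also have "\<dots> \<le> A x * (u \<bullet> u) + B x * (u \<bullet> x)\<^sup>2"
    using mult_left_mono_neg[OF Cauchy_Schwarz_ineq[of u x], of "B x"] False by simp
  finally show ?thesis by (simp add: met_def power2_eq_square mult.assoc)
qed

lemma met_eqI:
  assumes "x \<noteq> 0" "\<And>w. met x a w = met x b w"
  shows "a = b"
proof (rule ccontr)
  assume "a \<noteq> b"
  then have "met x (a - b) (a - b) > 0"
    using met_pos[OF assms(1)] by simp
  then show False
    by (simp add: assms(2) bilinear_lsub[OF met_bilinear])
qed

lemma met_sharp:
  assumes "x \<noteq> 0"
  shows "met x (sharp x y) w = y \<bullet> w"
proof -
  define L where "L = A x + B x * (x \<bullet> x)"
  have "A x > 0" "L > 0" "B x * (x \<bullet> x) = L - A x"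
    using A_pos[OF assms] radial_pos[OF assms] by (auto simp: L_def)
  have "sharp x y \<bullet> x = (y \<bullet> x - (B x * (x \<bullet> x)) * (y \<bullet> x) / L) / A x"
    by (simp add: sharp_def inner_simps L_def)
  also have "\<dots> = (y \<bullet> x) / L"
    unfolding \<open>B x * (x \<bullet> x) = L - A x\<close> using \<open>A x > 0\<close> \<open>L > 0\<close> by (simp add: field_simps)
  finally have "sharp x y \<bullet> x = (y \<bullet> x) / L" .
  moreover have "A x * (sharp x y \<bullet> w) = y \<bullet> w - B x / L * (y \<bullet> x) * (x \<bullet> w)"
    using \<open>A x > 0\<close> by (simp add: sharp_def inner_simps L_def)
  ultimately show ?thesis
    by (simp add: met_def inner_commute)
qed

lemma cubic_vec_inner: "cubic_vec x u v \<bullet> w = cubic x u v w"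
  by (simp add: cubic_vec_def cubic_def inner_simps inner_commute algebra_simps)

lemma met_gam: "x \<noteq> 0 \<Longrightarrow> met x (gam x u v) w = cubic x u v w / 2"
  by (simp add: gam_def met_sharp cubic_vec_inner)

lemma cubic_rotate: "cubic x u v w = cubic x u w v"
  by (simp add: cubic_def inner_commute algebra_simps)

lemma gam_sym: "gam x u v = gam x v u"
  by (simp add: gam_def cubic_vec_def inner_commute algebra_simps)

lemma sharp_linear: "linear (sharp x)"
proof -
  have "linear (\<lambda>y. a *\<^sub>R (y - (b * (y \<bullet> x)) *\<^sub>R x))" for a b
    by (intro linearI) (simp_all add: inner_simps algebra_simps)
  then show ?thesis unfolding sharp_def[abs_def] .
qed

lemma cubic_vec_linear: "linear (cubic_vec x u)"
  by (intro linearI) (simp_all add: cubic_vec_def inner_simps algebra_simps)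

lemma gam_linear: "linear (gam x u)"
  by (intro linearI)
    (simp_all add: gam_def linear_add[OF cubic_vec_linear] linear_scale[OF cubic_vec_linear]
      linear_add[OF sharp_linear] linear_scale[OF sharp_linear] scaleR_right_distrib)

lemma met_has_derivative:
  assumes "x \<noteq> 0" "(X has_derivative X') (at x)" "(Y has_derivative Y') (at x)"
  shows "((\<lambda>y. met y (X y) (Y y)) has_derivative
    (\<lambda>w. cubic x w (X x) (Y x) + met x (X' w) (Y x) + met x (X x) (Y' w))) (at x)"
  unfolding met_def
  by (rule derivative_eq_intros A_deriv B_deriv assms refl)+
    (simp add: cubic_def fun_eq_iff inner_simps inner_commute algebra_simps)

text \<open>\<open>Q\<close> is the fourth derivative of the potential. Its symmetry in the first
  two slots is what cancels it from the curvature.\<close>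

lemma cubic_has_derivative:
  assumes "x \<noteq> 0"
  obtains Q where "\<And>u v w. ((\<lambda>y. cubic y u v w) has_derivative (\<lambda>z. Q z u v w)) (at x)"
    "\<And>z u v w. Q z u v w = Q u z v w"
proof -
  obtain E where E: "(C has_derivative (\<lambda>w. E * (w \<bullet> x))) (at x)"
    using C_deriv[OF assms] by auto
  define Q where "Q = (\<lambda>z u v w. E * (z \<bullet> x) * (u \<bullet> x) * (v \<bullet> x) * (w \<bullet> x) +
    C x * ((z \<bullet> u) * (v \<bullet> x) * (w \<bullet> x) + (z \<bullet> v) * (u \<bullet> x) * (w \<bullet> x) + (z \<bullet> w) * (u \<bullet> x) * (v \<bullet> x) +
      (u \<bullet> v) * (z \<bullet> x) * (w \<bullet> x) + (u \<bullet> w) * (z \<bullet> x) * (v \<bullet> x) + (v \<bullet> w) * (z \<bullet> x) * (u \<bullet> x)) +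
    B x * ((z \<bullet> u) * (v \<bullet> w) + (z \<bullet> v) * (u \<bullet> w) + (z \<bullet> w) * (u \<bullet> v)))"
  show ?thesis
  proof (rule that)
    show "((\<lambda>y. cubic y u v w) has_derivative (\<lambda>z. Q z u v w)) (at x)" for u v w
      unfolding cubic_def
      by (rule derivative_eq_intros B_deriv assms E refl)+
        (simp add: Q_def fun_eq_iff inner_simps inner_commute algebra_simps)
    show "Q z u v w = Q u z v w" for z u v w
      by (simp add: Q_def inner_commute algebra_simps)
  qed
qed

lemma met_smooth:
  "open V \<Longrightarrow> V \<subseteq> UNIV - {0} \<Longrightarrow> smooth_on V X \<Longrightarrow> smooth_on V Y \<Longrightarrow> smooth_on V (\<lambda>x. met x (X x) (Y x))"
  unfolding met_def
  by (intro smooth_on_add smooth_on_mult smooth_on_inner smooth_on_id)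
    (auto intro: smooth_on_subset A_smooth B_smooth)

lemma gam_smooth:
  assumes "open V" "V \<subseteq> UNIV - {0}" "smooth_on V X" "smooth_on V Y"
  shows "smooth_on V (\<lambda>x. gam x (X x) (Y x))"
proof -
  note smooth = smooth_on_subset[OF A_smooth assms(2)] smooth_on_subset[OF B_smooth assms(2)]
    smooth_on_subset[OF C_smooth assms(2)]
  have pos: "A x > 0" "A x + B x * (x \<bullet> x) > 0" if "x \<in> V" for x
    using that assms(2) by (auto intro!: A_pos radial_pos)
  show ?thesis
    unfolding gam_def sharp_def cubic_vec_def
    by (intro smooth_on_scaleR smooth_on_add smooth_on_diff smooth_on_mult smooth_on_divide
        smooth_on_inner smooth_on_id smooth_on_const assms smooth pos)
qed

lemma met_riemannian: "riemannian_metric (UNIV - {0}) met"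
  unfolding riemannian_metric_def
  by (auto simp: met_bilinear met_pos intro: met_sym met_smooth[OF open_punctured])

lemma conn_affine: "affine_connection (UNIV - {0}) conn"
  unfolding affine_connection_def
proof (intro allI impI, elim conjE, intro conjI ballI)
  fix V :: "(real^'n) set" and X Y Z :: "'n vfield" and h :: "real^'n \<Rightarrow> real"
  assume V: "open V" "V \<subseteq> UNIV - {0}" and X: "smooth_on V X" and Y: "smooth_on V Y" and Z: "smooth_on V Z"
    and h: "smooth_on V h"
  show "smooth_on V (conn X Y)"
    unfolding conn_def
    by (intro smooth_on_add smooth_on_derivative_along_field gam_smooth V X Y)
  fix x assume x: "x \<in> V"
  note dY = smooth_on_has_derivative[OF Y x] and dZ = smooth_on_has_derivative[OF Z x]
    and dh = smooth_on_has_derivative[OF h x]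
  have gam_linear': "linear (\<lambda>u. gam x u v)" for v
    using gam_linear[of x v] by (simp add: gam_sym[of x _ v])
  show "conn (\<lambda>y. X y + Y y) Z x = conn X Z x + conn Y Z x"
    by (simp add: conn_def linear_add[OF has_derivative_linear[OF dZ]] linear_add[OF gam_linear'])
  show "conn (\<lambda>y. h y *\<^sub>R X y) Y x = h x *\<^sub>R conn X Y x"
    by (simp add: conn_def linear_scale[OF has_derivative_linear[OF dY]] linear_scale[OF gam_linear']
        scaleR_right_distrib)
  show "conn X (\<lambda>y. Y y + Z y) x = conn X Y x + conn X Z x"
    by (simp add: conn_def frechet_derivative_eq[OF has_derivative_add[OF dY dZ]]
        linear_add[OF gam_linear])
  show "conn X (\<lambda>y. h y *\<^sub>R Y y) x =
      frechet_derivative h (at x) (X x) *\<^sub>R Y x + h x *\<^sub>R conn X Y x"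
    by (simp add: conn_def frechet_derivative_eq[OF has_derivative_scaleR[OF dh dY]]
        linear_scale[OF gam_linear] scaleR_right_distrib)
qed

text \<open>The derivative of the metric is \<open>cubic\<close>, and each of the two
  \<open>gam\<close> terms supplies half of it.\<close>

lemma conn_levi_civita: "levi_civita (UNIV - {0}) met conn"
  unfolding levi_civita_def
proof (intro conjI conn_affine)
  show "torsion_free (UNIV - {0}) conn"
    unfolding torsion_free_def conn_def lie_bracket_def by (auto simp: gam_sym)
  show "metric_compatible (UNIV - {0}) met conn"
    unfolding metric_compatible_def
  proof (intro allI impI, elim conjE, intro ballI)
    fix V :: "(real^'n) set" and X Y Z :: "'n vfield" and x
    assume V: "open V" "V \<subseteq> UNIV - {0}" "x \<in> V" and "smooth_on V X"
      and Y: "smooth_on V Y" and Z: "smooth_on V Z"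
    have x: "x \<noteq> 0" using V by auto
    have "met x (gam x (X x) (Y x)) (Z x) + met x (Y x) (gam x (X x) (Z x)) = cubic x (X x) (Y x) (Z x)"
      using cubic_rotate[of x "X x" "Y x" "Z x"]
      by (simp add: met_sym[of x "Y x"] met_gam[OF x])
    then show "frechet_derivative (\<lambda>y. met y (Y y) (Z y)) (at x) (X x) =
        met x (conn X Y x) (Z x) + met x (Y x) (conn X Z x)"
      unfolding frechet_derivative_eq[OF met_has_derivative[OF x smooth_on_has_derivative[OF Y V(3)]
            smooth_on_has_derivative[OF Z V(3)]]]
      by (simp add: conn_def bilinear_ladd[OF met_bilinear] bilinear_radd[OF met_bilinear])
  qed
qed

text \<open>Through uniqueness, claims about an arbitrary Levi-Civita connection become claims about
  the explicit \<open>conn\<close>, also on smaller open sets.\<close>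

lemma levi_civita_eq_conn:
  assumes "levi_civita (UNIV - {0}) met D" "open V" "V \<subseteq> UNIV - {0}" "x \<in> V" "smooth_on V X" "smooth_on V Y"
  shows "D X Y x = conn X Y x"
  by (rule levi_civita_unique[OF met_riemannian assms(1) conn_levi_civita assms(2-)])

section \<open>Self-adjointness and vanishing trace of the difference tensor\<close>

lemma difference_tensor_eq:
  assumes "levi_civita (UNIV - {0}) met D" "open V" "V \<subseteq> UNIV - {0}" "x \<in> V" "smooth_on V X" "smooth_on V Y"
  shows "difference_tensor D canonical_connection X Y x = gam x (X x) (Y x)"
  using levi_civita_eq_conn[OF assms]
  by (simp add: difference_tensor_def canonical_connection_def conn_def)

lemma difference_tensor_self_adjoint:
  assumes D: "levi_civita (UNIV - {0}) met D" and x: "x \<noteq> 0"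
    and X: "smooth_on (UNIV - {0}) X" and Y: "smooth_on (UNIV - {0}) Y"
  shows "adjoint_tensor (UNIV - {0}) met (difference_tensor D canonical_connection) X Y x =
    difference_tensor D canonical_connection X Y x"
proof -
  note eq = difference_tensor_eq[OF D open_punctured order_refl _ X]
  have adj: "met x (gam x u v) w = met x v (gam x u w)" for u v w
    using cubic_rotate[of x u v w] by (simp add: met_gam[OF x] met_sym[of x v])
  show ?thesis
    unfolding adjoint_tensor_def
  proof (rule the_equality)
    show "\<forall>Z. smooth_on (UNIV - {0}) Z \<longrightarrow>
      met x (difference_tensor D canonical_connection X Y x) (Z x) =
      met x (Y x) (difference_tensor D canonical_connection X Z x)"
      using x by (simp add: eq Y adj)
    fix w
    assume w: "\<forall>Z. smooth_on (UNIV - {0}) Z \<longrightarrow>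
      met x w (Z x) = met x (Y x) (difference_tensor D canonical_connection X Z x)"
    \<comment> \<open>Constant fields reach every tangent vector, so nondegeneracy gives the
      uniqueness that \<open>THE\<close> demands.\<close>
    have "met x w z = met x (gam x (X x) (Y x)) z" for z
      using w[rule_format, of "\<lambda>_. z"] x by (simp add: eq adj)
    from met_eqI[OF x this] show "w = difference_tensor D canonical_connection X Y x"
      using x by (simp add: eq Y)
  qed
qed

text \<open>The trace is \<open>sharp\<close> of a multiple of \<open>x\<close>. The frame sums in
  its coefficient follow from expanding \<open>x\<close> in the frame and from counting
  \<open>met x (e i) (e i)\<close>; \<open>det_const\<close> makes the coefficient zero.\<close>

lemma frame_trace_zero:
  assumes D: "levi_civita (UNIV - {0}) met D" and V: "open V" "V \<subseteq> UNIV - {0}" "x \<in> V"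
    and E: "orthonormal_frame V met E"
  shows "frame_trace E (difference_tensor D canonical_connection) x = 0"
proof -
  define L where "L = A x + B x * (x \<bullet> x)"
  define e where "e = (\<lambda>i. E i x)"
  have x: "x \<noteq> 0" using V by auto
  have pos: "A x > 0" "L > 0" using A_pos[OF x] radial_pos[OF x] by (auto simp: L_def)
  have ortho: "met x (e i) (e j) = (if i = j then 1 else 0)" for i j
    using E V(3) by (simp add: orthonormal_frame_def e_def)
  \<comment> \<open>The position vector is an eigenvector of the metric with eigenvalue
    \<open>L\<close>, so its frame coefficients are \<open>L * (e i \<bullet> x)\<close>.\<close>
  have "met x x v = L * (v \<bullet> x)" for v
    by (simp add: met_def L_def inner_commute algebra_simps)
  with orthonormal_expansion[of "met x" e x, OF met_bilinear ortho]
  have "x = L *\<^sub>R (\<Sum>i\<in>UNIV. (e i \<bullet> x) *\<^sub>R e i)"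
    by (simp add: scaleR_sum_right)
  from arg_cong[OF this, of "\<lambda>v. (1 / L) *\<^sub>R v"]
  have s1: "(\<Sum>i\<in>UNIV. (e i \<bullet> x) *\<^sub>R e i) = (1 / L) *\<^sub>R x"
    using pos by simp
  have s2: "(\<Sum>i\<in>UNIV. (e i \<bullet> x) * (e i \<bullet> x)) = (x \<bullet> x) / L"
    using arg_cong[OF s1, of "\<lambda>v. v \<bullet> x"] by (simp add: inner_sum_left)
  have "(\<Sum>i\<in>UNIV. met x (e i) (e i)) = real CARD('n)"
    by (simp add: ortho)
  then have s3: "A x * (\<Sum>i\<in>UNIV. e i \<bullet> e i) = real CARD('n) - B x * ((x \<bullet> x) / L)"
    by (simp add: met_def sum.distrib mult.assoc s2 flip: sum_distrib_left)
  have "(\<Sum>i\<in>UNIV. cubic_vec x (e i) (e i)) =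
      (2 * B x) *\<^sub>R (\<Sum>i\<in>UNIV. (e i \<bullet> x) *\<^sub>R e i) + (B x * (\<Sum>i\<in>UNIV. e i \<bullet> e i)) *\<^sub>R x +
      (C x * (\<Sum>i\<in>UNIV. (e i \<bullet> x) * (e i \<bullet> x))) *\<^sub>R x"
    by (simp add: cubic_vec_def scaleR_sum_right scaleR_sum_left sum_distrib_left sum.distrib
        algebra_simps flip: scaleR_2)
  also have "\<dots> = (2 * B x / L + B x * (\<Sum>i\<in>UNIV. e i \<bullet> e i) + C x * ((x \<bullet> x) / L)) *\<^sub>R x"
    by (simp add: s1 s2 algebra_simps)
  also have "2 * B x / L + B x * (\<Sum>i\<in>UNIV. e i \<bullet> e i) + C x * ((x \<bullet> x) / L) = 0"
  proof -
    \<comment> \<open>The factor \<open>A x * L\<close> clears the denominators and produces exactly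
      the expression in \<open>det_const\<close>.\<close>
    have "A x * L * (2 * B x / L + B x * (\<Sum>i\<in>UNIV. e i \<bullet> e i) + C x * ((x \<bullet> x) / L)) =
        2 * A x * B x + B x * L * (A x * (\<Sum>i\<in>UNIV. e i \<bullet> e i)) + A x * C x * (x \<bullet> x)"
      using pos by (simp add: field_simps)
    also have "\<dots> = 2 * A x * B x + B x * (real CARD('n) * L - B x * (x \<bullet> x)) + A x * C x * (x \<bullet> x)"
      unfolding s3 using pos by (simp add: field_simps)
    also have "\<dots> = 0"
      using det_const[OF x] by (simp add: L_def algebra_simps)
    finally show ?thesis using pos by simp
  qed
  finally have "(\<Sum>i\<in>UNIV. cubic_vec x (e i) (e i)) = 0" by simp
  moreover have "frame_trace E (difference_tensor D canonical_connection) x = (\<Sum>i\<in>UNIV. gam x (e i) (e i))"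
    using E by (simp add: frame_trace_def orthonormal_frame_def e_def difference_tensor_eq[OF D V])
  ultimately show ?thesis
    by (simp add: gam_def linear_scale[OF sharp_linear] linear_0[OF sharp_linear]
        flip: scaleR_sum_right linear_sum[OF sharp_linear])
qed

section \<open>Traces of endomorphisms and the Ricci curvature\<close>

lemma trace_gam:
  assumes x: "x \<noteq> 0"
  shows "trace (matrix (gam x a)) = 0"
proof -
  define L where "L = A x + B x * (x \<bullet> x)"
  have pos: "A x > 0" "L > 0" using A_pos[OF x] radial_pos[OF x] by (auto simp: L_def)
  have gam: "gam x a w = (1 / (2 * A x * L)) *\<^sub>R (L *\<^sub>R cubic_vec x a w - (B x * (cubic_vec x a w \<bullet> x)) *\<^sub>R x)" for w
    using pos by (simp add: gam_def sharp_def L_def[symmetric] algebra_simps)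
  have diag: "gam x a (axis i 1) $ i = (1 / (2 * A x * L)) *
      (L * (B x * (a \<bullet> x) + (2 * B x) * (a $ i * x $ i) + (C x * (a \<bullet> x)) * (x $ i * x $ i)) -
       B x * ((2 * B x * (a \<bullet> x) + C x * (a \<bullet> x) * (x \<bullet> x)) * (x $ i * x $ i) +
              (B x * (x \<bullet> x)) * (a $ i * x $ i)))" for i
  proof -
    have "axis i (1::real) $ i = 1" by (simp add: axis_def)
    then show ?thesis
      by (simp add: gam cubic_vec_def inner_simps inner_axis inner_axis' algebra_simps)
  qed
  have sums: "(\<Sum>i\<in>UNIV. a $ i * x $ i) = a \<bullet> x" "(\<Sum>i\<in>UNIV. x $ i * x $ i) = x \<bullet> x"
    by (simp_all add: inner_vec_def)
  have "trace (matrix (gam x a)) = (1 / (2 * A x * L)) *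
      (L * (B x * (real CARD('n) * (a \<bullet> x)) + (2 * B x) * (a \<bullet> x) + (C x * (a \<bullet> x)) * (x \<bullet> x)) -
       B x * ((2 * B x * (a \<bullet> x) + C x * (a \<bullet> x) * (x \<bullet> x)) * (x \<bullet> x) + (B x * (x \<bullet> x)) * (a \<bullet> x)))"
    unfolding trace_matrix diag
    by (simp only: sum_distrib_left[symmetric] sum.distrib sum_subtractf sums sum_constant)
  \<comment> \<open>This is half the derivative of the logarithm of the determinant of the metric in
    direction \<open>a\<close>; the second factor is the expression in \<open>det_const\<close>,
    multiplied by \<open>a \<bullet> x\<close>.\<close>
  also have "\<dots> = (1 / (2 * A x * L)) * ((a \<bullet> x) * (B x * ((real CARD('n) + 2) * A x +
      (real CARD('n) - 1) * B x * (x \<bullet> x)) + C x * (x \<bullet> x) * A x))"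
    by (simp add: L_def algebra_simps)
  finally show ?thesis by (simp add: det_const[OF x])
qed

text \<open>\<open>gam x u\<close> factors as \<open>S\<close>, \<open>S\<close>, \<open>T\<close>,
  where \<open>S\<close> is the positive square root of \<open>sharp x\<close> and \<open>T\<close>
  is the Euclidean self-adjoint operator given by half of \<open>cubic_vec x u\<close>.\<close>

lemma trace_gam_square_nonneg:
  assumes x: "x \<noteq> 0"
  shows "trace (matrix (\<lambda>w. gam x u (gam x u w))) \<ge> 0"
proof -
  define L where "L = A x + B x * (x \<bullet> x)"
  have pos: "A x > 0" "L > 0" "x \<bullet> x > 0"
    using A_pos[OF x] radial_pos[OF x] x by (auto simp: L_def)
  \<comment> \<open>\<open>S\<close> has eigenvalue \<open>p\<close> orthogonally to
    \<open>x\<close> and \<open>p + k * (x \<bullet> x)\<close> along \<open>x\<close>. They are the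
    inverse square roots of the eigenvalues \<open>A x\<close> and \<open>L\<close> of the metric,
    which determines \<open>k\<close>.\<close>
  define p where "p = 1 / sqrt (A x)"
  define k where "k = (1 / sqrt L - p) / (x \<bullet> x)"
  define S where "S = (\<lambda>y. p *\<^sub>R y + (k * (y \<bullet> x)) *\<^sub>R x)"
  define T where "T = (\<lambda>w. (1 / 2) *\<^sub>R cubic_vec x u w)"
  have p2: "p * p = 1 / A x"
    using pos by (simp add: p_def flip: real_sqrt_mult)
  have "p + k * (x \<bullet> x) = 1 / sqrt L"
    using pos by (simp add: k_def)
  then have "(p + k * (x \<bullet> x)) * (p + k * (x \<bullet> x)) = 1 / L"
    using pos by (simp flip: real_sqrt_mult)
  then have "(2 * p * k + k * k * (x \<bullet> x)) * (x \<bullet> x) = 1 / L - 1 / A x"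
    using p2 by (simp add: algebra_simps)
  also have "\<dots> = - (B x / (A x * L)) * (x \<bullet> x)"
    using pos by (simp add: field_simps) (simp add: L_def algebra_simps)
  finally have k2: "2 * p * k + k * k * (x \<bullet> x) = - (B x / (A x * L))"
    using pos by (simp only: mult_right_cancel)
  have SS: "S (S y) = sharp x y" for y
  proof -
    have "S y \<bullet> x = (p + k * (x \<bullet> x)) * (y \<bullet> x)"
      by (simp add: S_def inner_simps algebra_simps)
    then have "S (S y) = (p * p) *\<^sub>R y + (p * (k * (y \<bullet> x)) + k * ((p + k * (x \<bullet> x)) * (y \<bullet> x))) *\<^sub>R x"
      by (simp add: S_def[abs_def] scaleR_right_distrib scaleR_left_distrib)
    moreover have "p * (k * (y \<bullet> x)) + k * ((p + k * (x \<bullet> x)) * (y \<bullet> x)) = (2 * p * k + k * k * (x \<bullet> x)) * (y \<bullet> x)"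
      by (simp add: algebra_simps)
    ultimately have "S (S y) = (p * p) *\<^sub>R y + ((2 * p * k + k * k * (x \<bullet> x)) * (y \<bullet> x)) *\<^sub>R x"
      by (simp only:)
    also have "\<dots> = sharp x y"
      unfolding p2 k2 by (simp add: sharp_def L_def algebra_simps)
    finally show ?thesis .
  qed
  have "trace (matrix (\<lambda>w. S (S (T (S (S (T w))))))) \<ge> 0"
  proof (rule trace_square_self_adjoint_nonneg[where S = S and T = T])
    show "linear S"
      by (intro linearI) (simp_all add: S_def inner_simps algebra_simps)
    show "linear T"
      by (intro linearI)
        (simp_all add: T_def linear_add[OF cubic_vec_linear] linear_scale[OF cubic_vec_linear] scaleR_right_distrib)
    show "S v \<bullet> w = v \<bullet> S w" for v w
      by (simp add: S_def inner_simps inner_commute algebra_simps)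
    show "T v \<bullet> w = v \<bullet> T w" for v w
      using cubic_vec_inner[of x u v w] cubic_vec_inner[of x u w v] cubic_rotate[of x u v w]
      by (simp add: T_def inner_commute)
  qed
  then show ?thesis by (simp add: SS gam_def T_def)
qed

text \<open>Constant fields commute, so only the derivative of \<open>gam\<close> and the product of
  two \<open>gam\<close> remain. The former contributes the symmetric \<open>Q\<close>, which
  cancels, and -2 times the product; with the explicit product the coefficient becomes -1, which
  reverses the usual order of the commutator.\<close>

lemma curvature_constant_fields:
  assumes D: "levi_civita (UNIV - {0}) met D" and x: "x \<noteq> 0"
  shows "curvature D (\<lambda>_. w) (\<lambda>_. u) (\<lambda>_. v) x = gam x u (gam x w v) - gam x w (gam x u v)"
proof -
  define G where "G = (\<lambda>u w. frechet_derivative (\<lambda>y. gam y u v) (at x) w)"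
  have xM: "x \<in> UNIV - {0}" using x by simp
  have D_eq: "D X Y y = conn X Y y"
    if "y \<noteq> 0" "smooth_on (UNIV - {0}) X" "smooth_on (UNIV - {0}) Y" for X Y y
    using levi_civita_eq_conn[OF D open_punctured order_refl] that by simp
  have D_const: "D (\<lambda>_. u) (\<lambda>_. v) y = gam y u v" if "y \<noteq> 0" for u y
    using that by (simp add: D_eq conn_def frechet_derivative_const)
  have gam_sm: "smooth_on (UNIV - {0}) (\<lambda>y. gam y u v)" for u
    using gam_smooth[OF open_punctured order_refl] by simp
  have "smooth_on (UNIV - {0}) (D (\<lambda>_. u) (\<lambda>_. v))" for u
    by (rule smooth_on_cong[OF open_punctured _ gam_sm]) (simp add: D_const)
  \<comment> \<open>The outer covariant derivative differentiates \<open>D u v\<close>, so the two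
    fields have to agree on a neighbourhood of \<open>x\<close>.\<close>
  moreover have "frechet_derivative (D (\<lambda>_. u) (\<lambda>_. v)) (at x) = frechet_derivative (\<lambda>y. gam y u v) (at x)" for u
    by (rule frechet_derivative_cong_open[OF open_punctured xM]) (simp add: D_const)
  ultimately have DD: "D (\<lambda>_. w) (D (\<lambda>_. u) (\<lambda>_. v)) x = G u w + gam x w (gam x u v)" for u w
    by (subst D_eq[OF x]) (simp_all add: conn_def G_def D_const[OF x])
  have "gam x 0 v = 0"
    using linear_0[OF gam_linear] by (simp add: gam_sym[of x 0])
  then have D0: "D (lie_bracket (\<lambda>_. w) (\<lambda>_. u)) (\<lambda>_. v) x = 0"
    using x by (simp add: lie_bracket_def[abs_def] frechet_derivative_const D_const)
  obtain Q where Q: "\<And>u v w. ((\<lambda>y. cubic y u v w) has_derivative (\<lambda>z. Q z u v w)) (at x)"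
    and Q_sym: "\<And>z u v w. Q z u v w = Q u z v w"
    using cubic_has_derivative[OF x] by blast
  \<comment> \<open>Differentiating \<open>met y (gam y u v) z = cubic y u v z / 2\<close> also
    differentiates the metric, which yields a further \<open>cubic\<close>, equal to
    \<open>2 * met x (gam x w (gam x u v)) z\<close>.\<close>
  have G: "met x (G u w) z = Q w u v z / 2 - 2 * met x (gam x w (gam x u v)) z" for u w z
  proof -
    have "((\<lambda>y. met y (gam y u v) z) has_derivative
        (\<lambda>w. cubic x w (gam x u v) z + met x (G u w) z + met x (gam x u v) 0)) (at x)"
      unfolding G_def
      by (rule met_has_derivative[OF x smooth_on_has_derivative[OF gam_sm xM] has_derivative_const])
    moreover have "((\<lambda>y. met y (gam y u v) z) has_derivative (\<lambda>w. Q w u v z / 2)) (at x)"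
      by (rule has_derivative_transform_within_open[OF
            bounded_linear.has_derivative[OF bounded_linear_divide Q] open_punctured xM])
        (simp_all add: met_gam)
    ultimately have "(\<lambda>w. cubic x w (gam x u v) z + met x (G u w) z + met x (gam x u v) 0) = (\<lambda>w. Q w u v z / 2)"
      by (rule has_derivative_unique)
    from fun_cong[OF this, of w] show ?thesis
      by (simp add: met_gam[OF x] bilinear_rzero[OF met_bilinear])
  qed
  show ?thesis
  proof (rule met_eqI[OF x])
    show "met x (curvature D (\<lambda>_. w) (\<lambda>_. u) (\<lambda>_. v) x) z =
        met x (gam x u (gam x w v) - gam x w (gam x u v)) z" for z
      using Q_sym[of w u v z]
      by (simp add: curvature_def DD D0 bilinear_lsub[OF met_bilinear] bilinear_ladd[OF met_bilinear] G)
  qed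
qed

text \<open>With \<open>v = u\<close>, symmetry of \<open>gam\<close> moves the traced vector
  \<open>w\<close> into the last slot, leaving two endomorphisms with known traces.\<close>

lemma ricci_nonneg:
  assumes D: "levi_civita (UNIV - {0}) met D" and x: "x \<noteq> 0"
  shows "ricci D x u u \<ge> 0"
proof -
  have "curvature D (\<lambda>_. w) (\<lambda>_. u) (\<lambda>_. u) x = gam x u (gam x u w) - gam x (gam x u u) w" for w
    using gam_sym[of x w u] gam_sym[of x w "gam x u u"] by (simp only: curvature_constant_fields[OF D x])
  then have "ricci D x u u = trace (matrix (\<lambda>w. gam x u (gam x u w))) - trace (matrix (gam x (gam x u u)))"
    by (simp add: ricci_def trace_matrix sum_subtractf)
  then show ?thesis
    using trace_gam_square_nonneg[OF x] trace_gam[OF x] by simp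
qed

end

section \<open>From the Hessian of a function to the explicit metric\<close>

lemma riemannian_metric_cong:
  assumes "open U" "\<And>x. x \<in> U \<Longrightarrow> g x = g' x" "riemannian_metric U g"
  shows "riemannian_metric U g'"
  using assms(3) smooth_on_cong[OF assms(1), of "\<lambda>x. g x u v" "\<lambda>x. g' x u v" for u v]
  by (auto simp: riemannian_metric_def assms(2))

text \<open>The Hessian form and \<open>met\<close> are compared only away from the origin;
  compatibility differentiates the metric, and agreement on the open set \<open>V\<close> suffices
  for that.\<close>

lemma levi_civita_cong:
  fixes g g' :: "'n::finite bilin_field"
  assumes "\<And>x. x \<in> U \<Longrightarrow> g x = g' x" "levi_civita U g D"
  shows "levi_civita U g' D"
proof -
  have "metric_compatible U g' D"
    unfolding metric_compatible_def
  proof (intro allI impI, elim conjE, intro ballI)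
    fix V and X Y Z :: "'n vfield" and x
    assume V: "open V" "V \<subseteq> U" "x \<in> V" and sm: "smooth_on V X" "smooth_on V Y" "smooth_on V Z"
    have "frechet_derivative (\<lambda>y. g' y (Y y) (Z y)) (at x) = frechet_derivative (\<lambda>y. g y (Y y) (Z y)) (at x)"
      by (rule frechet_derivative_cong_open[OF V(1,3)]) (use V assms(1) in auto)
    moreover have "frechet_derivative (\<lambda>y. g y (Y y) (Z y)) (at x) (X x) =
        g x (D X Y x) (Z x) + g x (Y x) (D X Z x)"
      using assms(2) V sm unfolding levi_civita_def metric_compatible_def by blast
    ultimately show "frechet_derivative (\<lambda>y. g' y (Y y) (Z y)) (at x) (X x) =
        g' x (D X Y x) (Z x) + g' x (Y x) (D X Z x)"
      using assms(1)[of x] V by auto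
  qed
  then show ?thesis
    using assms(2) by (simp add: levi_civita_def)
qed

lemma (in radial_hessian) hessian_form_eq_met:
  assumes f: "\<And>y. y \<noteq> 0 \<Longrightarrow> (f has_derivative (\<lambda>w. A y * (w \<bullet> y))) (at y)" and x: "x \<noteq> 0"
  shows "hessian_form f x = met x"
proof (intro ext)
  fix u v
  have partial_f: "partial j f y = A y * y $ j" if "y \<noteq> 0" for j y
    by (simp add: partial_def frechet_derivative_eq[OF f[OF that]] inner_axis')
  have "partial i (partial j f) x = B x * x $ i * x $ j + A x * (if i = j then 1 else 0)" for i j
  proof -
    have "((\<lambda>y. A y * y $ j) has_derivative (\<lambda>w. A x * w $ j + B x * (w \<bullet> x) * x $ j)) (at x)"
      by (intro has_derivative_mult A_deriv x bounded_linear.has_derivative[OF bounded_linear_vec_nth]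
          has_derivative_ident)
    then have "(partial j f has_derivative (\<lambda>w. A x * w $ j + B x * (w \<bullet> x) * x $ j)) (at x)"
      by (rule has_derivative_transform_within_open[OF _ open_punctured]) (use x partial_f in auto)
    moreover have "axis i (1::real) $ j = (if i = j then 1 else 0)"
      by (simp add: axis_def)
    ultimately show ?thesis
      by (simp add: partial_def[of i] frechet_derivative_eq inner_axis')
  qed
  then have "partial i (partial j f) x * u $ i * v $ j =
      B x * ((u $ i * x $ i) * (v $ j * x $ j)) + (if i = j then A x * (u $ i * v $ j) else 0)" for i j
    by (simp add: algebra_simps)
  then have "hessian_form f x u v =
      B x * ((\<Sum>i\<in>UNIV. u $ i * x $ i) * (\<Sum>j\<in>UNIV. v $ j * x $ j)) +
      (\<Sum>i\<in>UNIV. \<Sum>j\<in>UNIV. if i = j then A x * (u $ i * v $ j) else 0)"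
    unfolding hessian_form_def sum_product by (simp only: sum_distrib_left sum.distrib)
  also have "\<dots> = met x u v"
    by (simp add: met_def inner_vec_def mult.assoc flip: sum_distrib_left)
  finally show "hessian_form f x u v = met x u v" .
qed

lemma radial_has_derivative:
  fixes x :: "'a::real_inner"
  assumes "x \<noteq> 0" "(\<phi> has_real_derivative d) (at (norm x))"
  shows "((\<lambda>y. \<phi> (norm y)) has_derivative (\<lambda>w. d / norm x * (w \<bullet> x))) (at x)"
proof -
  have "(norm has_derivative (\<lambda>w. w \<bullet> sgn x)) (at x)"
    using GDERIV_norm[OF assms(1)] by (simp add: gderiv_def)
  from has_derivative_compose[OF this assms(2)[unfolded has_field_derivative_def]]
  show ?thesis
    by (simp add: sgn_div_norm divide_inverse mult.assoc)
qed

lemma smooth_on_norm: "smooth_on (UNIV - {0}) (norm :: 'a::real_inner \<Rightarrow> real)"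
proof (rule smooth_on_cong)
  show "open (UNIV - {0::'a})" by (simp add: open_delete)
  then show "smooth_on (UNIV - {0::'a}) (\<lambda>x. (x \<bullet> x) powr (1 / 2))"
    by (intro smooth_on_powr smooth_on_inner smooth_on_id) auto
qed (simp add: powr_half_sqrt norm_eq_sqrt_inner)

section \<open>The potential of the theorem\<close>

text \<open>
  The derivatives \<open>F', F'', F'''\<close> at \<open>s = r\<^sup>2/2\<close> of the function \<open>F\<close> with \<open>F(r\<^sup>2/2) = \<integral>\<^sub>0\<^sup>r (t\<^sup>n + c)\<^bsup>1/n\<^esup> dt\<close>,
  expressed in terms of \<open>r\<close>; differentiation with respect to \<open>s\<close> is \<open>r\<^sup>-\<^sup>1 d/dr\<close>.
\<close>

definition coefA :: "real \<Rightarrow> nat \<Rightarrow> real \<Rightarrow> real" where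
  "coefA c n r = (r ^ n + c) powr (1 / n) / r"

definition coefB :: "real \<Rightarrow> nat \<Rightarrow> real \<Rightarrow> real" where
  "coefB c n r = - c * (r ^ n + c) powr (1 / n - 1) / r ^ 3"

definition coefC :: "real \<Rightarrow> nat \<Rightarrow> real \<Rightarrow> real" where
  "coefC c n r = c * (r ^ n + c) powr (1 / n - 2) * ((real n + 2) * r ^ n + 3 * c) / r ^ 5"

context
  fixes c r :: real and n :: nat
  assumes c: "c > 0" and r: "r > 0" and n: "n > 0"
begin

lemma base_pos: "r ^ n + c > 0"
  using c r by (simp add: add_pos_pos)

lemma powr_has_derivative:
  "((\<lambda>r. (r ^ n + c) powr a) has_real_derivative a * (r ^ n + c) powr (a - 1) * (real n * r ^ (n - 1))) (at r)"
  using base_pos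
  by (auto intro!: derivative_eq_intros DERIV_fun_powr[where g = "\<lambda>r. r ^ n + c" and r = a, simplified])

text \<open>Brings all real powers down to one common exponent, after which the identities below are
  rational in \<open>r\<close>, \<open>r ^ n\<close> and one remaining power.\<close>

lemma powr_step: "(r ^ n + c) powr a = (r ^ n + c) * (r ^ n + c) powr (a - 1)"
  using base_pos by (simp add: powr_diff)

lemma coefA_deriv: "(coefA c n has_real_derivative r * coefB c n r) (at r)"
proof -
  \<comment> \<open>The successor form turns \<open>r ^ (n - 1) * r\<close> into
    \<open>r ^ n\<close>.\<close>
  obtain m where m: "n = Suc m" using n gr0_conv_Suc by blast
  have "((\<lambda>r. (r ^ n + c) powr (1 / n) / r) has_real_derivative
      (1 / n * (r ^ n + c) powr (1 / n - 1) * (real n * r ^ (n - 1)) * r - (r ^ n + c) powr (1 / n) * 1) / (r * r)) (at r)"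
    using r by (intro DERIV_divide powr_has_derivative DERIV_ident) auto
  moreover have "(1 / n * (r ^ n + c) powr (1 / n - 1) * (real n * r ^ (n - 1)) * r - (r ^ n + c) powr (1 / n) * 1) / (r * r)
      = r * coefB c n r"
  proof -
    define q where "q = (r ^ n + c) powr (1 / n - 1)"
    have "1 / n * q * (real n * r ^ (n - 1)) * r = q * r ^ n"
      using n by (simp add: m)
    then show ?thesis
      unfolding powr_step[of "1 / n"] coefB_def q_def[symmetric] using r
      by (simp add: field_simps power3_eq_cube)
  qed
  ultimately show ?thesis
    by (simp add: coefA_def[abs_def])
qed

lemma coefB_deriv: "(coefB c n has_real_derivative r * coefC c n r) (at r)"
proof -
  obtain m where m: "n = Suc m" using n gr0_conv_Suc by blast
  have "((\<lambda>r. - c * (r ^ n + c) powr (1 / n - 1) / r ^ 3) has_real_derivative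
      (- c * ((1 / n - 1) * (r ^ n + c) powr (1 / n - 1 - 1) * (real n * r ^ (n - 1))) * r ^ 3 -
        - c * (r ^ n + c) powr (1 / n - 1) * (real 3 * r ^ (3 - Suc 0))) / (r ^ 3 * r ^ 3)) (at r)"
    using r by (intro DERIV_divide DERIV_cmult powr_has_derivative DERIV_pow) auto
  moreover have "(- c * ((1 / n - 1) * (r ^ n + c) powr (1 / n - 1 - 1) * (real n * r ^ (n - 1))) * r ^ 3 -
        - c * (r ^ n + c) powr (1 / n - 1) * (real 3 * r ^ (3 - Suc 0))) / (r ^ 3 * r ^ 3)
      = r * coefC c n r"
  proof -
    define q where "q = (r ^ n + c) powr (1 / n - 2)"
    define t where "t = (1 / n - 1) * q * (real n * r ^ (n - 1))"
    have t: "t = (1 - real n) * q * r ^ n / r"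
      using r n by (simp add: t_def m field_simps)
    have "(- c * t * r ^ 3 - - c * ((r ^ n + c) * q) * (real 3 * r ^ (3 - Suc 0))) / (r ^ 3 * r ^ 3)
      = r * (c * q * ((real n + 2) * r ^ n + 3 * c) / r ^ 5)"
      unfolding t using r by (simp add: field_simps eval_nat_numeral)
    moreover have "1 / real n - 1 - 1 = 1 / real n - 2" by simp
    ultimately show ?thesis
      unfolding powr_step[of "1 / n - 1"] coefC_def q_def t_def by simp
  qed
  ultimately show ?thesis
    by (simp add: coefB_def[abs_def])
qed

lemma coefC_deriv: "\<exists>d. (coefC c n has_real_derivative d) (at r)"
  unfolding coefC_def[abs_def]
  by (rule exI, rule DERIV_divide[OF DERIV_mult[OF DERIV_cmult[OF powr_has_derivative]
          DERIV_add[OF DERIV_cmult[OF DERIV_pow] DERIV_const]] DERIV_pow])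
    (use r in simp)

text \<open>The left side is the second derivative of the radial profile,
  \<open>r^(n-1) * (r^n + c)^(1/n - 1)\<close>.\<close>

lemma coef_radial_pos: "coefA c n r + coefB c n r * r\<^sup>2 > 0"
proof -
  have "coefA c n r + coefB c n r * r\<^sup>2 = r ^ n * (r ^ n + c) powr (1 / n - 1) / r"
    unfolding coefA_def coefB_def powr_step[of "1 / n"] using r
    by (simp add: field_simps eval_nat_numeral)
  then show ?thesis using r base_pos by simp
qed

text \<open>Up to the factor \<open>A^(n-2)\<close> this is the derivative in
  \<open>s = r^2/2\<close> of the product of eigenvalues \<open>A^(n-1) * (A + B * r^2)\<close>,
  which is identically 1.\<close>

lemma coef_det_const:
  "coefB c n r * ((real n + 2) * coefA c n r + (real n - 1) * coefB c n r * r\<^sup>2) +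
    coefC c n r * r\<^sup>2 * coefA c n r = 0"
proof -
  define q where "q = (r ^ n + c) powr (1 / n - 2)"
  have q: "(r ^ n + c) powr (1 / n - 1) = (r ^ n + c) * q"
    using powr_step[of "1 / n - 1"] by (simp add: q_def)
  show ?thesis
    unfolding coefA_def coefB_def coefC_def powr_step[of "1 / n"] q q_def[symmetric] using r
    by (simp add: field_simps eval_nat_numeral)
qed

lemma powr_conjugate: "(r ^ n + c) powr (1 / n - 1) = 1 / (r ^ n + c) powr ((real n - 1) / real n)"
proof -
  have "1 / real n - 1 + (real n - 1) / real n = 0" using n by (simp add: field_simps)
  then have "(r ^ n + c) powr (1 / n - 1) * (r ^ n + c) powr ((real n - 1) / real n) = 1"
    using base_pos by (simp only: flip: powr_add) simp
  then show ?thesis using base_pos by (simp add: field_simps)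
qed

lemma coefA_closed: "coefA c n r = (r ^ n + c) * r\<^sup>2 / (r ^ 3 * (r ^ n + c) powr ((real n - 1) / real n))"
  unfolding coefA_def powr_step[of "1 / n"] powr_conjugate using r
  by (simp add: power2_eq_square power3_eq_cube)

lemma coefB_closed: "coefB c n r = - c / (r ^ 3 * (r ^ n + c) powr ((real n - 1) / real n))"
  unfolding coefB_def powr_conjugate by simp

lemma potential_profile_deriv:
  "((\<lambda>r. integral {0..r} (\<lambda>t. (t ^ n + c) powr (1 / n))) has_real_derivative r * coefA c n r) (at r)"
proof -
  \<comment> \<open>The interval extends past \<open>r\<close> to make \<open>r\<close> an interior
    point, so that the derivative within the interval is two-sided. Continuity at
    \<open>t = 0\<close> rests on \<open>c > 0\<close>.\<close>
  have "continuous_on {0..r + 1} (\<lambda>t. (t ^ n + c) powr (1 / n))"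
  proof (intro continuous_intros ballI)
    fix t assume "t \<in> {0..r + 1}"
    then have "t ^ n + c > 0" using c by (auto intro: add_nonneg_pos)
    then show "t ^ n + c \<noteq> 0" by simp
  qed
  then have "((\<lambda>r. integral {0..r} (\<lambda>t. (t ^ n + c) powr (1 / n))) has_real_derivative (r ^ n + c) powr (1 / n))
      (at r within {0..r + 1})"
    using r by (intro integral_has_real_derivative) auto
  moreover have "at r within {0..r + 1} = at r"
    using r by (intro at_within_interior) (auto simp: interior_atLeastAtMost_real)
  ultimately show ?thesis
    using r by (simp add: coefA_def)
qed

end

section \<open>The potential as an instance of a radial Hessian\<close>

lemma coefC_smooth:
  assumes "c > 0"
  shows "smooth_on (UNIV - {0}) (\<lambda>x :: 'a::real_inner. coefC c n (norm x))"
  unfolding coefC_def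
proof (intro smooth_on_divide smooth_on_mult smooth_on_add smooth_on_powr smooth_on_power
    smooth_on_const smooth_on_norm)
  show "norm x ^ n + c > 0" for x :: 'a
    using assms by (auto intro: add_nonneg_pos)
qed (auto simp: open_delete)

lemma radial_hessian_coef:
  assumes "c > 0"
  shows "radial_hessian (\<lambda>x :: real^'n::finite. coefA c CARD('n) (norm x)) (\<lambda>x. coefB c CARD('n) (norm x))
    (\<lambda>x. coefC c CARD('n) (norm x))"
proof
  fix x :: "real^'n"
  assume x: "x \<noteq> 0"
  then have r: "norm x > 0" by simp
  note coef = assms r zero_less_card_finite[where 'a = 'n]
  show "((\<lambda>x. coefA c CARD('n) (norm x)) has_derivative (\<lambda>w. coefB c CARD('n) (norm x) * (w \<bullet> x))) (at x)"
    using radial_has_derivative[OF x coefA_deriv[OF coef]] r by simp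
  show "((\<lambda>x. coefB c CARD('n) (norm x)) has_derivative (\<lambda>w. coefC c CARD('n) (norm x) * (w \<bullet> x))) (at x)"
    using radial_has_derivative[OF x coefB_deriv[OF coef]] r by simp
  show "\<exists>E. ((\<lambda>x. coefC c CARD('n) (norm x)) has_derivative (\<lambda>w. E * (w \<bullet> x))) (at x)"
    using coefC_deriv[OF coef] radial_has_derivative[OF x] by blast
  show "coefA c CARD('n) (norm x) > 0"
    using r base_pos[OF coef] by (simp add: coefA_def)
  show "coefA c CARD('n) (norm x) + coefB c CARD('n) (norm x) * (x \<bullet> x) > 0"
    using coef_radial_pos[OF coef] by (simp add: dot_square_norm)
  show "coefB c CARD('n) (norm x) * ((real CARD('n) + 2) * coefA c CARD('n) (norm x) +
      (real CARD('n) - 1) * coefB c CARD('n) (norm x) * (x \<bullet> x)) +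
      coefC c CARD('n) (norm x) * (x \<bullet> x) * coefA c CARD('n) (norm x) = 0"
    using coef_det_const[OF coef] by (simp add: dot_square_norm)
qed (rule coefC_smooth[OF assms])

lemma potential_has_derivative:
  fixes x :: "real^'n::finite"
  assumes "c > 0" "x \<noteq> 0"
  shows "(potential c has_derivative (\<lambda>w. coefA c CARD('n) (norm x) * (w \<bullet> x))) (at x)"
proof -
  have "norm x > 0" using assms by simp
  from radial_has_derivative[OF assms(2) potential_profile_deriv[OF assms(1) this zero_less_card_finite[where 'a = 'n]]]
  show ?thesis
    using assms by (simp add: potential_def[abs_def])
qed

theorem theorem8p4:
  fixes c :: real
    and f :: "real^'n::finite \<Rightarrow> real"
    and g :: "real^'n \<Rightarrow> real^'n \<Rightarrow> real^'n \<Rightarrow> real"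
    and M :: "(real^'n) set"
    and n :: nat
  assumes "n = CARD('n)" and "n \<ge> 2" and "c > 0"
    and "M = UNIV - {0}"
    and "f = potential c"
    and "g = hessian_form f"
  shows "smooth_on M f \<and>
    riemannian_metric M g \<and>
    affine_riemann_manifold M canonical_connection g \<and>
    (\<exists>D. levi_civita M g D) \<and>
    (\<forall>D. levi_civita M g D \<longrightarrow>
       (let \<gamma> = difference_tensor D canonical_connection in
         (\<forall>X Y. smooth_on M X \<and> smooth_on M Y \<longrightarrow>
            (\<forall>x\<in>M. \<gamma> X Y x = adjoint_tensor M g \<gamma> X Y x)) \<and>
         (\<forall>V E. open V \<and> V \<subseteq> M \<and> orthonormal_frame V g E \<longrightarrow>
            (\<forall>x\<in>V. frame_trace E \<gamma> x = 0))) \<and>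
       (\<forall>x\<in>M. \<forall>u. ricci D x u u \<ge> 0)) \<and>
    (\<forall>x\<in>M. let r = norm x; d = r ^ 3 * (r ^ n + c) powr ((real n - 1) / real n) in
       (\<forall>i. g x (axis i 1) (axis i 1) = (r ^ (n + 2) + c * (r\<^sup>2 - (x $ i)\<^sup>2)) / d) \<and>
       (\<forall>i j. i \<noteq> j \<longrightarrow> g x (axis i 1) (axis j 1) = - (c * x $ i * x $ j) / d) \<and>
       (\<forall>u v. g x u v =
          1 / d * ((r ^ n + c) * r\<^sup>2 * (u \<bullet> v) - c * (u \<bullet> x) * (v \<bullet> x))))"
proof -
  interpret radial_hessian "\<lambda>x :: real^'n. coefA c n (norm x)" "\<lambda>x. coefB c n (norm x)"
    "\<lambda>x. coefC c n (norm x)"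
    using radial_hessian_coef[OF \<open>c > 0\<close>] by (simp add: \<open>n = CARD('n)\<close>)
  have n: "n > 0" using \<open>n \<ge> 2\<close> by simp
  have df: "(f has_derivative (\<lambda>w. coefA c n (norm x) * (w \<bullet> x))) (at x)" if "x \<noteq> 0" for x
    using potential_has_derivative[OF \<open>c > 0\<close> that] by (simp add: \<open>f = _\<close> \<open>n = _\<close>)
  have openM: "open M" unfolding \<open>M = _\<close> by (rule open_punctured)
  have g_met: "g x = met x" if "x \<in> M" for x
    using hessian_form_eq_met[OF df] that by (simp add: \<open>M = _\<close> \<open>g = _\<close>)
  have "smooth_on M f"
    unfolding \<open>M = _\<close>
    by (rule smooth_onI[OF open_punctured df])
      (auto intro!: smooth_on_mult smooth_on_inner A_smooth open_punctured)
  moreover have metric: "riemannian_metric M g"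
    by (rule riemannian_metric_cong[OF openM _ met_riemannian[folded \<open>M = _\<close>]]) (simp add: g_met)
  moreover have "affine_riemann_manifold M canonical_connection g"
    using metric openM canonical_connection_affine canonical_connection_flat
      canonical_connection_torsion_free
    by (auto simp: affine_riemann_manifold_def)
  moreover have "levi_civita M g conn"
    by (rule levi_civita_cong[OF _ conn_levi_civita[folded \<open>M = _\<close>]]) (simp add: g_met)
  moreover have "(let \<gamma> = difference_tensor D canonical_connection in
         (\<forall>X Y. smooth_on M X \<and> smooth_on M Y \<longrightarrow>
            (\<forall>x\<in>M. \<gamma> X Y x = adjoint_tensor M g \<gamma> X Y x)) \<and>
         (\<forall>V E. open V \<and> V \<subseteq> M \<and> orthonormal_frame V g E \<longrightarrow>
            (\<forall>x\<in>V. frame_trace E \<gamma> x = 0))) \<and>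
       (\<forall>x\<in>M. \<forall>u. ricci D x u u \<ge> 0)" if "levi_civita M g D" for D
  proof -
    have D: "levi_civita M met D"
      by (rule levi_civita_cong[OF g_met that])
    have "difference_tensor D canonical_connection X Y x =
        adjoint_tensor M g (difference_tensor D canonical_connection) X Y x"
      if "smooth_on M X" "smooth_on M Y" "x \<in> M" for X Y x
    proof -
      \<comment> \<open>The adjoint uses the metric only at the point \<open>x\<close>, so pointwise
        agreement is enough here.\<close>
      have "adjoint_tensor M g (difference_tensor D canonical_connection) X Y x =
          adjoint_tensor M met (difference_tensor D canonical_connection) X Y x"
        by (simp add: adjoint_tensor_def g_met[OF that(3)])
      then show ?thesis
        using difference_tensor_self_adjoint[of D x X Y] D that by (simp add: \<open>M = _\<close>)
    qed
    moreover have "frame_trace E (difference_tensor D canonical_connection) x = 0"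
      if V: "open V" "V \<subseteq> M" "orthonormal_frame V g E" "x \<in> V" for V E x
    proof -
      have "g y = met y" if "y \<in> V" for y
        using g_met V(2) that by auto
      then have "orthonormal_frame V met E"
        using V(3) by (simp add: orthonormal_frame_def)
      then show ?thesis
        using frame_trace_zero[of D V x E] D V by (simp add: \<open>M = _\<close>)
    qed
    moreover have "ricci D x u u \<ge> 0" if "x \<in> M" for x u
      using ricci_nonneg[of D x u] D that by (simp add: \<open>M = _\<close>)
    ultimately show ?thesis by (auto simp: Let_def)
  qed
  moreover have "let r = norm x; d = r ^ 3 * (r ^ n + c) powr ((real n - 1) / real n) in
       (\<forall>i. g x (axis i 1) (axis i 1) = (r ^ (n + 2) + c * (r\<^sup>2 - (x $ i)\<^sup>2)) / d) \<and>
       (\<forall>i j. i \<noteq> j \<longrightarrow> g x (axis i 1) (axis j 1) = - (c * x $ i * x $ j) / d) \<and>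
       (\<forall>u v. g x u v =
          1 / d * ((r ^ n + c) * r\<^sup>2 * (u \<bullet> v) - c * (u \<bullet> x) * (v \<bullet> x)))" if "x \<in> M" for x
  proof -
    define r where "r = norm x"
    define d where "d = r ^ 3 * (r ^ n + c) powr ((real n - 1) / real n)"
    have r: "r > 0" using that by (simp add: \<open>M = _\<close> r_def)
    have form: "g x u v = 1 / d * ((r ^ n + c) * r\<^sup>2 * (u \<bullet> v) - c * (u \<bullet> x) * (v \<bullet> x))" for u v
      unfolding g_met[OF that] met_def r_def[symmetric] coefA_closed[OF \<open>c > 0\<close> r n]
        coefB_closed[OF \<open>c > 0\<close> r n] d_def[symmetric]
      by (simp add: diff_divide_distrib)
    have "axis i (1::real) \<bullet> axis j 1 = (if i = j then 1 else 0)" for i j :: 'n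
      by (simp add: inner_axis_axis)
    \<comment> \<open>Both coordinate formulas specialise \<open>form\<close>: on the diagonal
      \<open>(r^n + c) * r^2\<close> splits into \<open>r^(n+2) + c * r^2\<close>, and off the
      diagonal the Euclidean term is zero.\<close>
    then show ?thesis
      unfolding Let_def r_def[symmetric] d_def[symmetric]
      by (auto simp: form inner_axis' algebra_simps power_add power2_eq_square
          add_divide_distrib diff_divide_distrib)
  qed
  ultimately show ?thesis by blast
qed

end
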